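(* Let $G$ be a finite $M$-group, let $N\triangleleft G$ be a normal subgroup and let $\theta\in\mathrm{Irr}(N)$. Suppose there exist an irreducible constituent $\chi$ of $\theta^G$ and a subgroup $H\in\mathcal{H}_G(\chi)$ such that $N''\cap H\subseteq H'$. Then $\theta$ is super-monomial (as an irreducible character of $N$).
   Context: All characters are complex characters of finite groups. $\mathrm{Irr}(G)$ is the set of irreducible characters of $G$; $\theta^G$ denotes the induced character. $H'$ denotes the commutator subgroup of $H$, and $N''=(N')'$ is the second derived subgroup of $N$. A character of $G$ is monomial if it is induced from a linear character of some subgroup of $G$; $G$ is an $M$-group if all its irreducible characters are monomial. For a monomial $\chi\in\mathrm{Irr}(G)$, $\mathcal{H}_G(\chi)$ is the set of subgroups $H\le G$ for which there exists a linear character $\lambda$ of $H$ with $\lambda^G=\chi$. An irreducible character is primitive if it is not induced from a character of any proper subgroup. An irreducible character $\chi$ of a group $G$ is super-monomial if every primitive character inducing it is linear, i.e. whenever $H\le G$ and $\theta\in\mathrm{Irr}(H)$ is primitive with $\theta^G=\chi$, we have $\theta(1)=1$. *)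

theory Defs
  imports
    Complex_Main
    "HOL-Algebra.Generated_Groups"
    "Jordan_Normal_Form.VS_Connect"
begin

section \<open>Complex representations\<close>

definition general_linear :: "nat \<Rightarrow> complex mat monoid" where
  "general_linear n = units_of (ring_mat TYPE(complex) n ())"

definition representation ::
  "('g, 'b) monoid_scheme \<Rightarrow> nat \<Rightarrow> ('g \<Rightarrow> complex mat) \<Rightarrow> bool" where
  "representation G n \<rho> \<longleftrightarrow> 0 < n \<and> \<rho> \<in> hom G (general_linear n)"

definition irreducible_representation ::
  "('g, 'b) monoid_scheme \<Rightarrow> nat \<Rightarrow> ('g \<Rightarrow> complex mat) \<Rightarrow> bool" where
  "irreducible_representation G n \<rho> \<longleftrightarrow> representation G n \<rho> \<and>
     (\<forall>W. VectorSpace.subspace class_ring W (module_vec TYPE(complex) n) \<longrightarrow>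
          (\<forall>g\<in>carrier G. \<forall>w\<in>W. \<rho> g *\<^sub>v w \<in> W) \<longrightarrow>
          W = {0\<^sub>v n} \<or> W = carrier_vec n)"

definition mat_trace :: "complex mat \<Rightarrow> complex" where
  "mat_trace A = (\<Sum>i<dim_row A. A $$ (i, i))"

section \<open>Characters\<close>

text \<open>Characters are total functions on the element type. They are set to \<open>0\<close> outside the
  carrier, so that equality of characters of the same group is equality of functions. A subgroup
  \<open>H\<close> of \<open>G\<close> is regarded as a group via \<open>G\<lparr>carrier := H\<rparr>\<close>.\<close>

definition afforded_char ::
  "('g, 'b) monoid_scheme \<Rightarrow> ('g \<Rightarrow> complex mat) \<Rightarrow> 'g \<Rightarrow> complex" where
  "afforded_char G \<rho> = (\<lambda>g. if g \<in> carrier G then mat_trace (\<rho> g) else 0)"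

definition characters :: "('g, 'b) monoid_scheme \<Rightarrow> ('g \<Rightarrow> complex) set" where
  "characters G = {\<chi>. \<exists>n \<rho>. representation G n \<rho> \<and> \<chi> = afforded_char G \<rho>}"

definition Irr :: "('g, 'b) monoid_scheme \<Rightarrow> ('g \<Rightarrow> complex) set" where
  "Irr G = {\<chi>. \<exists>n \<rho>. irreducible_representation G n \<rho> \<and> \<chi> = afforded_char G \<rho>}"

definition linear_characters :: "('g, 'b) monoid_scheme \<Rightarrow> ('g \<Rightarrow> complex) set" where
  "linear_characters G = {\<chi> \<in> characters G. \<chi> \<one>\<^bsub>G\<^esub> = 1}"

text \<open>The usual formula \<open>\<theta>\<^sup>G(g) = 1/|H| \<Sum>\<^sub>x \<theta>\<degree>(x g x\<inverse>)\<close>, where \<open>x\<close> ranges over \<open>G\<close> and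
  \<open>\<theta>\<degree>\<close> is the extension of \<open>\<theta>\<close> by \<open>0\<close> outside \<open>H\<close>.\<close>

definition induced_char ::
  "('g, 'b) monoid_scheme \<Rightarrow> 'g set \<Rightarrow> ('g \<Rightarrow> complex) \<Rightarrow> 'g \<Rightarrow> complex" where
  "induced_char G H \<theta> = (\<lambda>g. if g \<in> carrier G
     then (\<Sum>x\<in>carrier G.
             if x \<otimes>\<^bsub>G\<^esub> g \<otimes>\<^bsub>G\<^esub> inv\<^bsub>G\<^esub> x \<in> H then \<theta> (x \<otimes>\<^bsub>G\<^esub> g \<otimes>\<^bsub>G\<^esub> inv\<^bsub>G\<^esub> x) else 0)
          / of_nat (card H)
     else 0)"

text \<open>\<open>\<chi>\<close> is a constituent of \<open>\<zeta>\<close> if \<open>\<zeta> - \<chi>\<close> is a character or zero (\<open>0\<close> does not count as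
  a character).\<close>

definition irreducible_constituent ::
  "('g, 'b) monoid_scheme \<Rightarrow> ('g \<Rightarrow> complex) \<Rightarrow> ('g \<Rightarrow> complex) \<Rightarrow> bool" where
  "irreducible_constituent G \<chi> \<zeta> \<longleftrightarrow> \<chi> \<in> Irr G \<and>
     (\<zeta> = \<chi> \<or> (\<exists>\<psi>\<in>characters G. \<zeta> = (\<lambda>g. \<chi> g + \<psi> g)))"

section \<open>Monomial, primitive and super-monomial characters\<close>

definition monomial_subgroups ::
  "('g, 'b) monoid_scheme \<Rightarrow> ('g \<Rightarrow> complex) \<Rightarrow> 'g set set" where
  "monomial_subgroups G \<chi> = {H. subgroup H G \<and>
     (\<exists>\<mu>\<in>linear_characters (G\<lparr>carrier := H\<rparr>). induced_char G H \<mu> = \<chi>)}"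

definition monomial_char :: "('g, 'b) monoid_scheme \<Rightarrow> ('g \<Rightarrow> complex) \<Rightarrow> bool" where
  "monomial_char G \<chi> \<longleftrightarrow> (\<exists>H. subgroup H G \<and>
     (\<exists>\<mu>\<in>linear_characters (G\<lparr>carrier := H\<rparr>). induced_char G H \<mu> = \<chi>))"

definition M_group :: "('g, 'b) monoid_scheme \<Rightarrow> bool" where
  "M_group G \<longleftrightarrow> (\<forall>\<chi>\<in>Irr G. monomial_char G \<chi>)"

definition primitive_char :: "('g, 'b) monoid_scheme \<Rightarrow> ('g \<Rightarrow> complex) \<Rightarrow> bool" where
  "primitive_char G \<chi> \<longleftrightarrow> \<chi> \<in> Irr G \<and>
     \<not> (\<exists>H. subgroup H G \<and> H \<noteq> carrier G \<and>
          (\<exists>\<theta>\<in>characters (G\<lparr>carrier := H\<rparr>). induced_char G H \<theta> = \<chi>))"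

definition super_monomial :: "('g, 'b) monoid_scheme \<Rightarrow> ('g \<Rightarrow> complex) \<Rightarrow> bool" where
  "super_monomial G \<chi> \<longleftrightarrow> \<chi> \<in> Irr G \<and>
     (\<forall>H \<theta>. subgroup H G \<longrightarrow> \<theta> \<in> Irr (G\<lparr>carrier := H\<rparr>) \<longrightarrow>
        primitive_char (G\<lparr>carrier := H\<rparr>) \<theta> \<longrightarrow> induced_char G H \<theta> = \<chi> \<longrightarrow> \<theta> \<one>\<^bsub>G\<^esub> = 1)"

end

theory Submission
  imports Defs "HOL-Algebra.Multiplicative_Group"
begin

text \<open>Let \<open>D = N''\<close>, a normal subgroup of \<open>G\<close>, let \<open>\<chi>\<close> be induced from the linear
  character \<open>\<mu>\<close> of \<open>H\<close>, and let \<open>\<psi>\<close> be a primitive character of \<open>K \<le> N\<close> that induces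
  \<open>\<theta>\<close>. The proof follows the sum of a character over \<open>D\<close>. This is \<open>|D|\<close> times the
  dimension of the space of vectors fixed by \<open>D\<close>, so it is a natural number
  (\<open>sum_char_nat\<close>), and it behaves simply under induction: the sum over \<open>D\<close> of a character
  induced from \<open>X\<close> is a positive multiple of the sum of the original one over \<open>D \<inter> X\<close>
  (\<open>sum_induced_char_normal\<close>).

  By assumption \<open>D \<inter> H \<subseteq> H'\<close>, so \<open>\<mu>\<close> is \<open>1\<close> on \<open>D \<inter> H\<close> and the sum of \<open>\<chi>\<close> over \<open>D\<close> is
  not zero. Hence neither is that of \<open>\<theta>\<^sup>G\<close>, of which \<open>\<chi>\<close> is a part; nor that of \<open>\<theta>\<close>;
  nor the sum of \<open>\<psi>\<close> over \<open>D \<inter> K\<close>. So \<open>D \<inter> K\<close> has a nonzero fixed vector in the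
  irreducible representation that affords \<open>\<psi>\<close>. As \<open>D \<inter> K\<close> is normal in \<open>K\<close>, it acts
  trivially (\<open>normal_in_kernel\<close>), and in particular so does \<open>K''\<close>.

  It remains to see that a primitive character of a group that is metabelian modulo the kernel is
  linear (\<open>primitive_metabelian_degree_one\<close>). By Clifford's theorem, a normal subgroup
  whose elements act by commuting matrices acts by scalars in a primitive representation
  (\<open>abelian_normal_scalar\<close>). This applies to \<open>K'\<close>, then to the subgroup generated by
  \<open>K'\<close> and any one element. So all of \<open>K\<close> acts by scalars, and the degree is \<open>1\<close>.\<close>

section \<open>Traces, finite sums and idempotent matrices\<close>

lemma mat_trace_mult_comm:
  assumes "A \<in> carrier_mat n m" "B \<in> carrier_mat m n"
  shows "mat_trace (A * B) = mat_trace (B * A)"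
proof -
  have "mat_trace (A * B) = (\<Sum>i<n. \<Sum>j<m. A $$ (i,j) * B $$ (j,i))"
    using assms by (auto simp: mat_trace_def scalar_prod_def atLeast0LessThan)
  also have "\<dots> = (\<Sum>j<m. \<Sum>i<n. B $$ (j,i) * A $$ (i,j))"
    by (subst sum.swap) (simp add: mult.commute)
  also have "\<dots> = mat_trace (B * A)"
    using assms by (auto simp: mat_trace_def scalar_prod_def atLeast0LessThan)
  finally show ?thesis .
qed

lemma mat_trace_one: "mat_trace (1\<^sub>m n) = of_nat n"
  by (simp add: mat_trace_def)

lemma mat_trace_smult: "mat_trace (c \<cdot>\<^sub>m A) = c * mat_trace A" if "A \<in> carrier_mat n n"
  using that by (auto simp: mat_trace_def sum_distrib_left)

lemma mat_trace_zero: "mat_trace (0\<^sub>m n n) = 0"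
  by (simp add: mat_trace_def)

lemma smult_smult_mat: "a \<cdot>\<^sub>m (b \<cdot>\<^sub>m A) = (a * b) \<cdot>\<^sub>m (A :: 'a :: semigroup_mult mat)"
  by (rule eq_matI) (auto simp: mult.assoc)

lemma smult_one_mat [simp]: "1 \<cdot>\<^sub>m (A :: 'a :: monoid_mult mat) = A"
  by (rule eq_matI) auto

lemma zero_smult_mat: "A \<in> carrier_mat n m \<Longrightarrow> 0 \<cdot>\<^sub>m A = (0\<^sub>m n m :: 'a :: mult_zero mat)"
  by (rule eq_matI) auto

text \<open>Square matrices of a fixed size \<open>n\<close> do not form a type, so their sums cannot be written with
  \<^const>\<open>sum\<close>; the empty sum has to know \<open>n\<close>.\<close>

definition mat_sum :: "nat \<Rightarrow> ('i \<Rightarrow> complex mat) \<Rightarrow> 'i set \<Rightarrow> complex mat" where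
  "mat_sum n F I = mat n n (\<lambda>(i, j). \<Sum>a\<in>I. F a $$ (i, j))"

lemma mat_sum_carrier [simp]: "mat_sum n F I \<in> carrier_mat n n"
  and dim_mat_sum [simp]: "dim_row (mat_sum n F I) = n" "dim_col (mat_sum n F I) = n"
  by (simp_all add: mat_sum_def)

lemma mat_sum_cong: "(\<And>a. a \<in> I \<Longrightarrow> F a = F' a) \<Longrightarrow> mat_sum n F I = mat_sum n F' I"
  by (auto simp: mat_sum_def intro!: eq_matI sum.cong)

lemma mat_sum_reindex_bij_betw:
  assumes "bij_betw h I J"
  shows "mat_sum n (\<lambda>a. F (h a)) I = mat_sum n F J"
  unfolding mat_sum_def
  by (rule cong_mat) (simp_all add: sum.reindex_bij_betw[OF assms, of "\<lambda>a. F a $$ _"])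

lemma mat_sum_mult_left:
  assumes "B \<in> carrier_mat n n" "\<And>a. a \<in> I \<Longrightarrow> F a \<in> carrier_mat n n"
  shows "B * mat_sum n F I = mat_sum n (\<lambda>a. B * F a) I"
proof (rule eq_matI)
  fix i j assume "i < dim_row (mat_sum n (\<lambda>a. B * F a) I)" "j < dim_col (mat_sum n (\<lambda>a. B * F a) I)"
  then have ij: "i < n" "j < n" by auto
  have "(B * mat_sum n F I) $$ (i, j) = (\<Sum>k<n. \<Sum>a\<in>I. B $$ (i,k) * F a $$ (k,j))"
    using assms(1) ij
    by (auto simp: mat_sum_def scalar_prod_def atLeast0LessThan sum_distrib_left)
  also have "\<dots> = (\<Sum>a\<in>I. \<Sum>k<n. B $$ (i,k) * F a $$ (k,j))" by (rule sum.swap)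
  also have "\<dots> = (\<Sum>a\<in>I. (B * F a) $$ (i,j))"
  proof (rule sum.cong[OF refl])
    fix a assume "a \<in> I"
    then show "(\<Sum>k<n. B $$ (i,k) * F a $$ (k,j)) = (B * F a) $$ (i,j)"
      using assms(1) assms(2)[of a] ij by (auto simp: scalar_prod_def atLeast0LessThan)
  qed
  also have "\<dots> = mat_sum n (\<lambda>a. B * F a) I $$ (i, j)" using ij by (simp add: mat_sum_def)
  finally show "(B * mat_sum n F I) $$ (i, j) = mat_sum n (\<lambda>a. B * F a) I $$ (i, j)" .
qed (use assms in auto)

lemma mat_sum_mult_right:
  assumes "B \<in> carrier_mat n n" "\<And>a. a \<in> I \<Longrightarrow> F a \<in> carrier_mat n n"
  shows "mat_sum n F I * B = mat_sum n (\<lambda>a. F a * B) I"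
proof (rule eq_matI)
  fix i j assume "i < dim_row (mat_sum n (\<lambda>a. F a * B) I)" "j < dim_col (mat_sum n (\<lambda>a. F a * B) I)"
  then have ij: "i < n" "j < n" by auto
  have "(mat_sum n F I * B) $$ (i, j) = (\<Sum>k<n. \<Sum>a\<in>I. F a $$ (i,k) * B $$ (k,j))"
    using assms(1) ij
    by (auto simp: mat_sum_def scalar_prod_def atLeast0LessThan sum_distrib_right)
  also have "\<dots> = (\<Sum>a\<in>I. \<Sum>k<n. F a $$ (i,k) * B $$ (k,j))" by (rule sum.swap)
  also have "\<dots> = (\<Sum>a\<in>I. (F a * B) $$ (i,j))"
  proof (rule sum.cong[OF refl])
    fix a assume "a \<in> I"
    then show "(\<Sum>k<n. F a $$ (i,k) * B $$ (k,j)) = (F a * B) $$ (i,j)"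
      using assms(1) assms(2)[of a] ij by (auto simp: scalar_prod_def atLeast0LessThan)
  qed
  also have "\<dots> = mat_sum n (\<lambda>a. F a * B) I $$ (i, j)" using ij by (simp add: mat_sum_def)
  finally show "(mat_sum n F I * B) $$ (i, j) = mat_sum n (\<lambda>a. F a * B) I $$ (i, j)" .
qed (use assms in auto)

lemma mat_sum_smult:
  assumes "\<And>a. a \<in> I \<Longrightarrow> F a \<in> carrier_mat n n"
  shows "c \<cdot>\<^sub>m mat_sum n F I = mat_sum n (\<lambda>a. c \<cdot>\<^sub>m F a) I"
proof (rule eq_matI)
  fix i j assume "i < dim_row (mat_sum n (\<lambda>a. c \<cdot>\<^sub>m F a) I)" "j < dim_col (mat_sum n (\<lambda>a. c \<cdot>\<^sub>m F a) I)"
  then have ij: "i < n" "j < n" by auto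
  have "c * F a $$ (i, j) = (c \<cdot>\<^sub>m F a) $$ (i, j)" if "a \<in> I" for a
    using assms[OF that] ij by auto
  then show "(c \<cdot>\<^sub>m mat_sum n F I) $$ (i, j) = mat_sum n (\<lambda>a. c \<cdot>\<^sub>m F a) I $$ (i, j)"
    using ij by (simp add: mat_sum_def sum_distrib_left)
qed simp_all

lemma mat_sum_smult_const:
  assumes "A \<in> carrier_mat n n"
  shows "mat_sum n (\<lambda>a. f a \<cdot>\<^sub>m A) I = (\<Sum>a\<in>I. f a) \<cdot>\<^sub>m A"
  unfolding mat_sum_def using assms
  by (intro eq_matI) (auto simp: sum_distrib_right intro!: sum.cong)

lemma mat_trace_mat_sum:
  assumes "\<And>a. a \<in> I \<Longrightarrow> F a \<in> carrier_mat n n"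
  shows "mat_trace (mat_sum n F I) = (\<Sum>a\<in>I. mat_trace (F a))"
proof -
  have "mat_trace (mat_sum n F I) = (\<Sum>i<n. \<Sum>a\<in>I. F a $$ (i,i))"
    by (simp add: mat_trace_def mat_sum_def)
  also have "\<dots> = (\<Sum>a\<in>I. \<Sum>i<n. F a $$ (i,i))" by (rule sum.swap)
  also have "\<dots> = (\<Sum>a\<in>I. mat_trace (F a))"
    using assms by (intro sum.cong) (auto simp: mat_trace_def)
  finally show ?thesis .
qed

lemma mat_sum_swap:
  "mat_sum n (\<lambda>a. mat_sum n (F a) J) I = mat_sum n (\<lambda>b. mat_sum n (\<lambda>a. F a b) I) J"
  unfolding mat_sum_def
  by (intro eq_matI) (auto intro: sum.swap)

text \<open>If \<open>m > n\<close>, padding \<open>P\<close> with zero rows and \<open>Q\<close> with zero columns would give square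
  matrices that are inverse to each other on one side, hence on both; but the padded \<open>P * Q\<close> has a
  zero row.\<close>

lemma left_inverse_dim_le:
  fixes P Q :: "'a :: field mat"
  assumes "P \<in> carrier_mat n m" "Q \<in> carrier_mat m n" "Q * P = 1\<^sub>m m"
  shows "m \<le> n"
proof (rule ccontr)
  assume "\<not> m \<le> n"
  then have nm: "n < m" by simp
  define P' where "P' = mat m m (\<lambda>(i,j). if i < n then P $$ (i,j) else 0)"
  define Q' where "Q' = mat m m (\<lambda>(i,j). if j < n then Q $$ (i,j) else 0)"
  have "Q' * P' = 1\<^sub>m m"
  proof -
    have "Q' * P' = Q * P"
    proof (rule eq_matI)
      fix i j assume "i < dim_row (Q * P)" "j < dim_col (Q * P)"
      then have ij: "i < m" "j < m" using assms by auto
      have "(\<Sum>k<m. Q' $$ (i,k) * P' $$ (k,j)) = (\<Sum>k<n. Q $$ (i,k) * P $$ (k,j))"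
        using ij nm by (intro sum.mono_neutral_cong_right) (auto simp: P'_def Q'_def)
      moreover have "(Q' * P') $$ (i,j) = (\<Sum>k<m. Q' $$ (i,k) * P' $$ (k,j))"
        using ij by (simp add: P'_def Q'_def scalar_prod_def atLeast0LessThan)
      moreover have "(Q * P) $$ (i,j) = (\<Sum>k<n. Q $$ (i,k) * P $$ (k,j))"
        using ij assms(1,2) by (simp add: scalar_prod_def atLeast0LessThan)
      ultimately show "(Q' * P') $$ (i,j) = (Q * P) $$ (i,j)" by simp
    qed (use assms in \<open>auto simp: P'_def Q'_def\<close>)
    then show ?thesis using assms by simp
  qed
  then have "P' * Q' = 1\<^sub>m m"
    using mat_mult_left_right_inverse[of Q' m P'] by (simp add: P'_def Q'_def)
  then have "(P' * Q') $$ (n,n) = 1" using nm by simp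
  moreover have "(P' * Q') $$ (n,n) = 0" using nm
    by (simp add: P'_def Q'_def scalar_prod_def)
  ultimately show False by simp
qed

lemma mat_eq_if_mult_vec_eq:
  assumes "A \<in> carrier_mat n n" "B \<in> carrier_mat n n"
    and "\<And>v. v \<in> carrier_vec n \<Longrightarrow> A *\<^sub>v v = B *\<^sub>v v"
  shows "A = (B :: 'a :: semiring_1 mat)"
proof (rule mat_col_eqI)
  fix j assume "j < dim_col B"
  then have "j < n" using assms by auto
  then have "col A j = A *\<^sub>v unit_vec n j" "col B j = B *\<^sub>v unit_vec n j"
    using assms(1,2) by (auto intro!: eq_vecI)
  then show "col A j = col B j" using assms(3)[of "unit_vec n j"] by simp
qed (use assms in auto)

text \<open>The columns of \<open>P\<close> are a basis of the image of \<open>e\<close>, and \<open>Q\<close> gives the coordinates of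
  the projection in this basis. Thus conjugating by \<open>P\<close> and \<open>Q\<close> turns an action on the image into
  matrices, and the trace of \<open>e\<close> is the dimension \<open>m\<close>.

  The basis is built by splitting off rank one pieces: as long as the rest \<open>f = e - P * Q\<close> is
  not zero, a nonzero column of \<open>f\<close> and a suitably scaled row of \<open>f\<close> extend \<open>P\<close> and
  \<open>Q\<close>. The process stops because \<open>m \<le> n\<close>, so \<open>m\<close> is chosen maximal.\<close>

lemma idempotent_factorization:
  assumes e: "e \<in> carrier_mat n n" and idem: "e * e = (e :: 'a :: field mat)"
  obtains m P Q where "P \<in> carrier_mat n m" "Q \<in> carrier_mat m n"
    "Q * P = 1\<^sub>m m" "P * Q = e"
proof -
  define good where "good m \<longleftrightarrow> (\<exists>P Q. P \<in> carrier_mat n m \<and> Q \<in> carrier_mat m n \<and>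
     Q * P = 1\<^sub>m m \<and> e * P = P \<and> Q * e = Q)" for m
  have good0: "good 0"
    unfolding good_def using e
    by (intro exI[of _ "0\<^sub>m n 0"] exI[of _ "0\<^sub>m 0 n"]) auto
  have bound: "m \<le> n" if "good m" for m
    using that left_inverse_dim_le unfolding good_def by blast
  obtain m where m: "good m" and max: "\<And>m'. good m' \<Longrightarrow> m' \<le> m"
    using good0 bound
    by (metis (no_types, lifting) GreatestI_nat Greatest_le_nat)
  from m obtain P Q where P: "P \<in> carrier_mat n m" and Q: "Q \<in> carrier_mat m n"
    and QP: "Q * P = 1\<^sub>m m" and eP: "e * P = P" and Qe: "Q * e = Q"
    unfolding good_def by blast
  define f where "f = e - P * Q"
  have PQ: "P * Q \<in> carrier_mat n n" using P Q by auto
  have f: "f \<in> carrier_mat n n" unfolding f_def using PQ by (rule minus_carrier_mat)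
  have ePQ: "e * (P * Q) = P * Q" using eP assoc_mult_mat[OF e P Q] by simp
  have PQe: "(P * Q) * e = P * Q" using Qe assoc_mult_mat[OF P Q e] by simp
  have QPQ: "Q * (P * Q) = Q" using QP assoc_mult_mat[OF Q P Q] Q by simp
  have PQP: "(P * Q) * P = P" using QP assoc_mult_mat[OF P Q P] P by simp
  have PQPQ: "(P * Q) * (P * Q) = P * Q" using QPQ assoc_mult_mat[OF P Q PQ] by simp
  have ef: "e * f = f"
    unfolding f_def using mult_minus_distrib_mat[OF e e PQ] idem ePQ by simp
  have fe: "f * e = f"
    unfolding f_def using minus_mult_distrib_mat[OF e PQ e] idem PQe by simp
  have fP: "f * P = 0\<^sub>m n m"
    unfolding f_def using minus_mult_distrib_mat[OF e PQ P] eP PQP P by simp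
  have Qf: "Q * f = 0\<^sub>m m n"
    unfolding f_def using mult_minus_distrib_mat[OF Q e PQ] Qe QPQ Q by simp
  have ff: "f * f = f"
  proof -
    have "f * f = f * e - f * (P * Q)" 
      using mult_minus_distrib_mat[OF f e PQ] by (subst (2) f_def)
    also have "f * (P * Q) = 0\<^sub>m n n" using assoc_mult_mat[OF f P Q] fP Q by simp
    finally show ?thesis using fe f by auto
  qed
  have "f = 0\<^sub>m n n"
  proof (rule ccontr)
    assume "f \<noteq> 0\<^sub>m n n"
    then obtain r c where rc: "r < n" "c < n" "f $$ (r,c) \<noteq> 0"
      using f by (metis carrier_matD eq_matI index_zero_mat)
    \<comment> \<open>The scaling makes \<open>q \<bullet> p = (f * f) $$ (r, c) / f $$ (r, c) = 1\<close>.\<close>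
    define p where "p = col f c"
    define q where "q = (1 / f $$ (r,c)) \<cdot>\<^sub>v row f r"
    have p: "p \<in> carrier_vec n" and q: "q \<in> carrier_vec n" using f rc by (auto simp: p_def q_def)
    have rf: "row f r \<in> carrier_vec n" using f rc by auto
    define P' where "P' = mat n (Suc m) (\<lambda>(i,j). if j < m then P $$ (i,j) else p $ i)"
    define Q' where "Q' = mat (Suc m) n (\<lambda>(i,j). if i < m then Q $$ (i,j) else q $ j)"
    have P': "P' \<in> carrier_mat n (Suc m)" and Q': "Q' \<in> carrier_mat (Suc m) n"
      by (simp_all add: P'_def Q'_def)
    have colP': "col P' j = (if j < m then col P j else p)" if "j < Suc m" for j
      using that P p by (auto simp: P'_def)
    have rowQ': "row Q' i = (if i < m then row Q i else q)" if "i < Suc m" for i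
      using that Q q by (auto simp: Q'_def)
    have a1: "row Q i \<bullet> p = 0" if "i < m" for i
    proof -
      have "(Q * f) $$ (i,c) = row Q i \<bullet> col f c" using that Q f rc by simp
      then show ?thesis using Qf that rc by (simp add: p_def)
    qed
    have a2: "q \<bullet> col P j = 0" if "j < m" for j
    proof -
      have "(f * P) $$ (r,j) = row f r \<bullet> col P j" using that P f rc by simp
      then show ?thesis using fP that rc P f by (simp add: q_def)
    qed
    have a3: "q \<bullet> p = 1"
    proof -
      have "(f * f) $$ (r,c) = row f r \<bullet> col f c" using f rc by simp
      then show ?thesis using ff rc f by (simp add: q_def p_def)
    qed
    have a4: "row Q i \<bullet> col P j = (if i = j then 1 else 0)" if "i < m" "j < m" for i j
    proof -
      have "(Q * P) $$ (i,j) = row Q i \<bullet> col P j" using that P Q by simp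
      then show ?thesis using QP that by simp
    qed
    have Q'P': "Q' * P' = 1\<^sub>m (Suc m)"
      using P' Q' a1 a2 a3 a4 by (intro eq_matI) (auto simp: colP' rowQ' less_Suc_eq)
    have eP': "e * P' = P'"
    proof (rule eq_matI)
      fix i j assume "i < dim_row P'" "j < dim_col P'"
      then have ij: "i < n" "j < Suc m" using P' by auto
      have "row e i \<bullet> col P j = P $$ (i,j)" if "j < m"
      proof -
        have "(e * P) $$ (i,j) = row e i \<bullet> col P j" using that e P ij by simp
        then show ?thesis using eP by simp
      qed
      moreover have "row e i \<bullet> p = p $ i"
      proof -
        have "(e * f) $$ (i,c) = row e i \<bullet> p" using e f ij rc by (simp add: p_def)
        then show ?thesis using ef f ij rc by (simp add: p_def)
      qed
      ultimately show "(e * P') $$ (i,j) = P' $$ (i,j)"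
        using e P' ij by (simp add: colP') (auto simp: P'_def)
    qed (use e P' in auto)
    have Q'e: "Q' * e = Q'"
    proof (rule eq_matI)
      fix i j assume "i < dim_row Q'" "j < dim_col Q'"
      then have ij: "i < Suc m" "j < n" using Q' by auto
      have "row Q i \<bullet> col e j = Q $$ (i,j)" if "i < m"
      proof -
        have "(Q * e) $$ (i,j) = row Q i \<bullet> col e j" using that e Q ij by simp
        then show ?thesis using Qe by simp
      qed
      moreover have "q \<bullet> col e j = q $ j"
      proof -
        have "(f * e) $$ (r,j) = row f r \<bullet> col e j" using e f ij rc by simp
        then show ?thesis using fe f e ij rc by (simp add: q_def)
      qed
      ultimately show "(Q' * e) $$ (i,j) = Q' $$ (i,j)"
        using e Q' ij by (simp add: rowQ') (auto simp: Q'_def)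
    qed (use e Q' in auto)
    have "good (Suc m)" unfolding good_def using P' Q' Q'P' eP' Q'e by blast
    then show False using max by fastforce
  qed
  then have "P * Q = e"
  proof -
    have "e = f + P * Q" unfolding f_def using e PQ P Q by (intro eq_matI) auto
    then show ?thesis using \<open>f = 0\<^sub>m n n\<close> PQ by simp
  qed
  then show ?thesis using that P Q QP by blast
qed

section \<open>Representations of finite groups\<close>

text \<open>Invertibility of the matrices is automatic, because group elements have inverses.\<close>

lemma representation_iff:
  assumes "group G"
  shows "representation G n \<rho> \<longleftrightarrow> 0 < n \<and> (\<forall>x\<in>carrier G. \<rho> x \<in> carrier_mat n n) \<and>
    (\<forall>x\<in>carrier G. \<forall>y\<in>carrier G. \<rho> (x \<otimes>\<^bsub>G\<^esub> y) = \<rho> x * \<rho> y) \<and> \<rho> \<one>\<^bsub>G\<^esub> = 1\<^sub>m n"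
    (is "?L \<longleftrightarrow> ?R")
proof
  interpret G: group G by fact
  interpret R: ring "ring_mat TYPE(complex) n ()" by (rule ring_mat)
  have gl: "group (general_linear n)" unfolding general_linear_def by (rule R.units_group)
  {
    assume L: ?L
    then have h: "\<rho> \<in> hom G (general_linear n)" by (simp add: representation_def)
    have "\<rho> \<one>\<^bsub>G\<^esub> = 1\<^sub>m n" using hom_one[OF h \<open>group G\<close> gl]
      by (simp add: general_linear_def units_of_one ring_mat_simps)
    then show ?R using L h
      by (auto simp: representation_def hom_def general_linear_def units_of_carrier units_of_mult
          Units_def ring_mat_simps Pi_iff)
  next
    assume R: ?R
    have "\<rho> x \<in> Units (ring_mat TYPE(complex) n ())" if x: "x \<in> carrier G" for x
    proof -
      have "\<rho> x * \<rho> (inv\<^bsub>G\<^esub> x) = 1\<^sub>m n" "\<rho> (inv\<^bsub>G\<^esub> x) * \<rho> x = 1\<^sub>m n"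
        using R x by (metis G.inv_closed G.r_inv, metis G.inv_closed G.l_inv R x)
      moreover have "\<rho> (inv\<^bsub>G\<^esub> x) \<in> carrier_mat n n" using R x by auto
      ultimately show ?thesis using R x by (auto simp: Units_def ring_mat_simps)
    qed
    then show ?L using R
      by (auto simp: representation_def hom_def general_linear_def units_of_carrier units_of_mult
          ring_mat_simps)
  }
qed

locale finite_group_rep = group G for G (structure) +
  fixes n :: nat and \<rho> :: "'a \<Rightarrow> complex mat"
  assumes fin: "finite (carrier G)" and rep: "representation G n \<rho>"
begin

lemma degree_pos: "0 < n"
  and \<rho>_carrier [simp]: "x \<in> carrier G \<Longrightarrow> \<rho> x \<in> carrier_mat n n"
  and \<rho>_mult: "x \<in> carrier G \<Longrightarrow> y \<in> carrier G \<Longrightarrow> \<rho> (x \<otimes> y) = \<rho> x * \<rho> y"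
  and \<rho>_one [simp]: "\<rho> \<one> = 1\<^sub>m n"
  using rep unfolding representation_iff[OF group_axioms] by auto

lemma r_inv_cancel: "x \<in> carrier G \<Longrightarrow> y \<in> carrier G \<Longrightarrow> x \<otimes> (inv x \<otimes> y) = y"
  and l_inv_cancel: "x \<in> carrier G \<Longrightarrow> y \<in> carrier G \<Longrightarrow> inv x \<otimes> (x \<otimes> y) = y"
  by (simp_all flip: m_assoc)

lemma \<rho>_inv: "x \<in> carrier G \<Longrightarrow> \<rho> x * \<rho> (inv x) = 1\<^sub>m n" "x \<in> carrier G \<Longrightarrow> \<rho> (inv x) * \<rho> x = 1\<^sub>m n"
  by (simp_all flip: \<rho>_mult)

lemma mat_assoc: "A \<in> carrier_mat n n \<Longrightarrow> B \<in> carrier_mat n n \<Longrightarrow> C \<in> carrier_mat n n \<Longrightarrow>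
    A * B * C = A * (B * C)" for A B C :: "complex mat"
  by (rule assoc_mult_mat)

lemma mult_carrier_nn [simp]:
  "A \<in> carrier_mat n n \<Longrightarrow> B \<in> carrier_mat n n \<Longrightarrow> A * B \<in> carrier_mat n n" for A B :: "complex mat"
  by (rule mult_carrier_mat)

abbreviation char where "char \<equiv> afforded_char G \<rho>"

lemma char_one: "char \<one> = of_nat n"
  by (simp add: afforded_char_def mat_trace_one)

lemma commutant_subgroup:
  assumes B: "B \<in> carrier_mat n n"
  shows "subgroup {x \<in> carrier G. \<rho> x * B = B * \<rho> x} G" (is "subgroup ?C G")
proof (rule subgroupI)
  show "?C \<subseteq> carrier G" by blast
  have "\<one> \<in> ?C" using B by simp
  then show "?C \<noteq> {}" by blast
next
  fix x assume "x \<in> ?C"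
  then have x: "x \<in> carrier G" and eq: "\<rho> x * B = B * \<rho> x" by auto
  have "\<rho> (inv x) * B = \<rho> (inv x) * (B * \<rho> x) * \<rho> (inv x)"
    using x B by (simp add: mat_assoc \<rho>_inv)
  also have "\<dots> = \<rho> (inv x) * (\<rho> x * B) * \<rho> (inv x)" by (simp only: eq)
  also have "\<rho> (inv x) * (\<rho> x * B) = B"
    using mat_assoc[of "\<rho> (inv x)" "\<rho> x" B] x B by (simp add: \<rho>_inv)
  finally show "inv x \<in> ?C" using x by simp
next
  fix x y assume "x \<in> ?C" "y \<in> ?C"
  then have x: "x \<in> carrier G" "\<rho> x * B = B * \<rho> x" and y: "y \<in> carrier G" "\<rho> y * B = B * \<rho> y"
    by auto
  have "\<rho> x * \<rho> y * B = \<rho> x * (B * \<rho> y)" using x(1) y B by (simp add: mat_assoc)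
  also have "\<dots> = B * \<rho> x * \<rho> y" using x y(1) B mat_assoc[of "\<rho> x" B "\<rho> y"] by simp
  also have "\<dots> = B * (\<rho> x * \<rho> y)" using x(1) y(1) B by (simp add: mat_assoc)
  finally show "x \<otimes> y \<in> ?C" using x y by (simp add: \<rho>_mult)
qed

text \<open>The commutant of the generators contains the generators, hence the generated subgroup;
  then the commutant of the generated subgroup contains the generators, hence everything.\<close>

lemma commute_on_generate:
  assumes S: "S \<subseteq> carrier G"
    and comm: "\<And>a b. a \<in> S \<Longrightarrow> b \<in> S \<Longrightarrow> \<rho> a * \<rho> b = \<rho> b * \<rho> a"
    and a: "a \<in> generate G S" and b: "b \<in> generate G S"
  shows "\<rho> a * \<rho> b = \<rho> b * \<rho> a"
proof -
  have 1: "\<rho> x * \<rho> s = \<rho> s * \<rho> x" if "x \<in> generate G S" "s \<in> S" for x s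
  proof -
    have "\<rho> s \<in> carrier_mat n n" using that S by auto
    moreover have "S \<subseteq> {x \<in> carrier G. \<rho> x * \<rho> s = \<rho> s * \<rho> x}" using that S comm by blast
    ultimately show ?thesis using generate_subgroup_incl[OF _ commutant_subgroup] that by blast
  qed
  have "\<rho> b \<in> carrier_mat n n" using generate_in_carrier[OF S b] by simp
  moreover have "S \<subseteq> {x \<in> carrier G. \<rho> x * \<rho> b = \<rho> b * \<rho> x}" using b S 1 by force
  ultimately show ?thesis using generate_subgroup_incl[OF _ commutant_subgroup] a by blast
qed

end

section \<open>Isotypic projections\<close>

context finite_group_rep
begin

definition linear_char_on :: "'a set \<Rightarrow> ('a \<Rightarrow> complex) \<Rightarrow> bool" where
  "linear_char_on A l \<longleftrightarrow> (\<forall>a\<in>A. l a \<noteq> 0) \<and> (\<forall>a\<in>A. \<forall>b\<in>A. l (a \<otimes> b) = l a * l b)"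

text \<open>For a linear character \<open>l\<close> of a subgroup \<open>A\<close> this is the projection to the
  common eigenspace of \<open>A\<close> with eigenvalues \<open>l\<close>, written as an element of the group algebra.\<close>

definition isotypic :: "'a set \<Rightarrow> ('a \<Rightarrow> complex) \<Rightarrow> complex mat" where
  "isotypic A l = mat_sum n (\<lambda>a. (inverse (l a) / of_nat (card A)) \<cdot>\<^sub>m \<rho> a) A"

lemma isotypic_carrier [simp]: "isotypic A l \<in> carrier_mat n n"
  by (simp add: isotypic_def)

lemma isotypic_cong: "(\<And>a. a \<in> A \<Longrightarrow> l a = m a) \<Longrightarrow> isotypic A l = isotypic A m"
  unfolding isotypic_def by (rule mat_sum_cong) simp

lemma linear_char_on_one: "subgroup A G \<Longrightarrow> linear_char_on A (\<lambda>_. 1)"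
  by (simp add: linear_char_on_def)

lemma card_subgroup_pos: "subgroup A G \<Longrightarrow> 0 < card A"
  using finite_subset[OF subgroup.subset fin] subgroup.one_closed by (metis card_gt_0_iff empty_iff)

lemma isotypic_absorb:
  assumes A: "subgroup A G" and l: "linear_char_on A l" and b: "b \<in> A"
  shows "\<rho> b * isotypic A l = l b \<cdot>\<^sub>m isotypic A l"
    and "isotypic A l * \<rho> b = l b \<cdot>\<^sub>m isotypic A l"
proof -
  have A': "\<And>a. a \<in> A \<Longrightarrow> a \<in> carrier G" using A subgroup.mem_carrier by fast
  let ?F = "\<lambda>a. (inverse (l a) / of_nat (card A)) \<cdot>\<^sub>m \<rho> a"
  have bij1: "bij_betw (\<lambda>a. b \<otimes> a) A A" and bij2: "bij_betw (\<lambda>a. a \<otimes> b) A A"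
    by (rule bij_betw_byWitness[of _ "\<lambda>a. inv b \<otimes> a"];
        use A b A' in \<open>auto simp: subgroup.m_closed subgroup.m_inv_closed m_assoc[symmetric]\<close>)
      (rule bij_betw_byWitness[of _ "\<lambda>a. a \<otimes> inv b"];
        use A b A' in \<open>auto simp: subgroup.m_closed subgroup.m_inv_closed m_assoc\<close>)
  have "\<rho> b * isotypic A l = mat_sum n (\<lambda>a. \<rho> b * ?F a) A"
    unfolding isotypic_def using A' b by (subst mat_sum_mult_left) auto
  also have "\<dots> = mat_sum n (\<lambda>a. l b \<cdot>\<^sub>m ?F (b \<otimes> a)) A"
  proof (rule mat_sum_cong)
    fix a assume a: "a \<in> A"
    have "\<rho> b * ?F a = (inverse (l a) / of_nat (card A)) \<cdot>\<^sub>m \<rho> (b \<otimes> a)"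
      using A' a b by (simp add: \<rho>_mult mult_smult_distrib[of _ n n _ n])
    also have "\<dots> = l b \<cdot>\<^sub>m ?F (b \<otimes> a)"
      using l a b by (simp add: linear_char_on_def smult_smult_mat field_simps)
    finally show "\<rho> b * ?F a = l b \<cdot>\<^sub>m ?F (b \<otimes> a)" .
  qed
  also have "\<dots> = l b \<cdot>\<^sub>m mat_sum n (\<lambda>a. ?F (b \<otimes> a)) A"
    using A' b by (subst mat_sum_smult) auto
  also have "\<dots> = l b \<cdot>\<^sub>m isotypic A l"
    unfolding isotypic_def by (subst mat_sum_reindex_bij_betw[OF bij1, of n ?F]) simp
  finally show "\<rho> b * isotypic A l = l b \<cdot>\<^sub>m isotypic A l" .
  have "isotypic A l * \<rho> b = mat_sum n (\<lambda>a. ?F a * \<rho> b) A"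
    unfolding isotypic_def using A' b by (subst mat_sum_mult_right) auto
  also have "\<dots> = mat_sum n (\<lambda>a. l b \<cdot>\<^sub>m ?F (a \<otimes> b)) A"
  proof (rule mat_sum_cong)
    fix a assume a: "a \<in> A"
    have "?F a * \<rho> b = (inverse (l a) / of_nat (card A)) \<cdot>\<^sub>m \<rho> (a \<otimes> b)"
      using A' a b by (simp add: \<rho>_mult mult_smult_assoc_mat[of _ n n _ n])
    also have "\<dots> = l b \<cdot>\<^sub>m ?F (a \<otimes> b)"
      using l a b by (simp add: linear_char_on_def smult_smult_mat field_simps)
    finally show "?F a * \<rho> b = l b \<cdot>\<^sub>m ?F (a \<otimes> b)" .
  qed
  also have "\<dots> = l b \<cdot>\<^sub>m mat_sum n (\<lambda>a. ?F (a \<otimes> b)) A"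
    using A' b by (subst mat_sum_smult) auto
  also have "\<dots> = l b \<cdot>\<^sub>m isotypic A l"
    unfolding isotypic_def by (subst mat_sum_reindex_bij_betw[OF bij2, of n ?F]) simp
  finally show "isotypic A l * \<rho> b = l b \<cdot>\<^sub>m isotypic A l" .
qed

lemma isotypic_fixes:
  assumes A: "subgroup A G" and l: "linear_char_on A l" and X: "X \<in> carrier_mat n n"
    and eig: "\<And>a. a \<in> A \<Longrightarrow> \<rho> a * X = l a \<cdot>\<^sub>m X"
  shows "isotypic A l * X = X"
proof -
  have A': "\<And>a. a \<in> A \<Longrightarrow> a \<in> carrier G" using A subgroup.mem_carrier by fast
  have "isotypic A l * X = mat_sum n (\<lambda>a. (inverse (l a) / of_nat (card A)) \<cdot>\<^sub>m \<rho> a * X) A"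
    unfolding isotypic_def using A' X by (subst mat_sum_mult_right) auto
  also have "\<dots> = mat_sum n (\<lambda>a. (1 / of_nat (card A)) \<cdot>\<^sub>m X) A"
    by (rule mat_sum_cong)
      (use l X A' eig in \<open>auto simp: mult_smult_assoc_mat[of _ n n _ n] smult_smult_mat linear_char_on_def\<close>)
  also have "\<dots> = X"
    using card_subgroup_pos[OF A] X by (subst mat_sum_smult_const) auto
  finally show ?thesis .
qed

lemma isotypic_idem:
  assumes "subgroup A G" "linear_char_on A l"
  shows "isotypic A l * isotypic A l = isotypic A l"
  using isotypic_fixes[OF assms isotypic_carrier] isotypic_absorb(1)[OF assms] by blast

text \<open>Moving \<open>\<rho> a\<close> across the product shows that it scales \<open>isotypic A l * X\<close> both by
  \<open>l a\<close> and by \<open>c\<close>.\<close>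

lemma isotypic_kills:
  assumes A: "subgroup A G" and l: "linear_char_on A l" and X: "X \<in> carrier_mat n n"
    and a: "a \<in> A" and eig: "\<rho> a * X = c \<cdot>\<^sub>m X" and ne: "l a \<noteq> c"
  shows "isotypic A l * X = 0\<^sub>m n n"
proof -
  have a': "a \<in> carrier G" using A a subgroup.mem_carrier by fast
  let ?e = "isotypic A l"
  have eX: "?e * X \<in> carrier_mat n n" using X isotypic_carrier by (rule mult_carrier_mat[rotated])
  have "l a \<cdot>\<^sub>m (?e * X) = (?e * \<rho> a) * X"
    using X by (simp add: isotypic_absorb[OF A l a] mult_smult_assoc_mat[of _ n n _ n])
  also have "\<dots> = ?e * (c \<cdot>\<^sub>m X)" using X a' eig by (simp add: mat_assoc)
  also have "\<dots> = c \<cdot>\<^sub>m (?e * X)" using X by (simp add: mult_smult_distrib[of _ n n _ n])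
  finally have eq: "l a \<cdot>\<^sub>m (?e * X) = c \<cdot>\<^sub>m (?e * X)" .
  show ?thesis
  proof (rule eq_matI)
    fix i j assume "i < dim_row (0\<^sub>m n n :: complex mat)" "j < dim_col (0\<^sub>m n n :: complex mat)"
    then have ij: "i < n" "j < n" by auto
    have "(l a \<cdot>\<^sub>m (?e * X)) $$ (i,j) = (c \<cdot>\<^sub>m (?e * X)) $$ (i,j)" using eq by simp
    then have "l a * (?e * X) $$ (i,j) = c * (?e * X) $$ (i,j)"
      using ij eX by (metis carrier_matD index_smult_mat(1))
    then show "(?e * X) $$ (i,j) = 0\<^sub>m n n $$ (i,j)" using ne ij by simp
  qed (use eX in auto)
qed

text \<open>Conjugation by \<open>g\<close> permutes the isotypic components of a normal subgroup in the way in
  which it permutes the linear characters.\<close>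

lemma isotypic_conj:
  assumes A: "A \<lhd> G" and g: "g \<in> carrier G"
  shows "\<rho> g * isotypic A l * \<rho> (inv g) = isotypic A (\<lambda>a. l (inv g \<otimes> a \<otimes> g))"
proof -
  interpret A: normal A G by fact
  let ?m = "\<lambda>a. l (inv g \<otimes> a \<otimes> g)"
  let ?F = "\<lambda>a. (inverse (?m a) / of_nat (card A)) \<cdot>\<^sub>m \<rho> a"
  let ?c = "\<lambda>a. inverse (l a) / of_nat (card A)"
  have bij: "bij_betw (\<lambda>a. g \<otimes> a \<otimes> inv g) A A"
    by (rule bij_betw_byWitness[of _ "\<lambda>a. inv g \<otimes> a \<otimes> g"])
      (use g A.inv_op_closed1 A.inv_op_closed2 in
        \<open>auto simp: m_assoc r_inv_cancel l_inv_cancel\<close>)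
  have "\<rho> g * isotypic A l * \<rho> (inv g) = mat_sum n (\<lambda>a. \<rho> g * (?c a \<cdot>\<^sub>m \<rho> a) * \<rho> (inv g)) A"
    unfolding isotypic_def using g by (subst mat_sum_mult_left; (subst mat_sum_mult_right)?) auto
  also have "\<dots> = mat_sum n (\<lambda>a. ?F (g \<otimes> a \<otimes> inv g)) A"
  proof (rule mat_sum_cong)
    fix a assume a: "a \<in> A"
    then have "inv g \<otimes> (g \<otimes> a \<otimes> inv g) \<otimes> g = a"
      using g by (simp add: m_assoc) (simp add: m_assoc[symmetric])
    moreover have "\<rho> g * (?c a \<cdot>\<^sub>m \<rho> a) * \<rho> (inv g) = ?c a \<cdot>\<^sub>m \<rho> (g \<otimes> a \<otimes> inv g)"
      using a g by (simp add: \<rho>_mult mult_smult_distrib[of _ n n _ n] mult_smult_assoc_mat[of _ n n _ n])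
    ultimately show "\<rho> g * (?c a \<cdot>\<^sub>m \<rho> a) * \<rho> (inv g) = ?F (g \<otimes> a \<otimes> inv g)" by simp
  qed
  also have "\<dots> = isotypic A ?m"
    unfolding isotypic_def by (rule mat_sum_reindex_bij_betw[OF bij, of n ?F])
  finally show ?thesis .
qed

text \<open>For the trivial character the projection is the average of the subgroup, and its image is
  the fixed space. The sum of the character over the subgroup therefore counts the dimension of
  the fixed space.\<close>

abbreviation avg where "avg D \<equiv> isotypic D (\<lambda>_. 1)"

lemma avg_commutes:
  assumes D: "D \<lhd> G" and g: "g \<in> carrier G"
  shows "\<rho> g * avg D = avg D * \<rho> g"
proof -
  have "\<rho> g * avg D = \<rho> g * avg D * (\<rho> (inv g) * \<rho> g)"
    using g right_mult_one_mat[of "\<rho> g * avg D" n n] by (simp add: \<rho>_inv)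
  also have "\<dots> = \<rho> g * avg D * \<rho> (inv g) * \<rho> g"
    using g by (subst mat_assoc) auto
  finally show ?thesis using isotypic_conj[OF D g, of "\<lambda>_. 1"] by simp
qed

lemma sum_char_eq_trace_avg:
  assumes D: "subgroup D G"
  shows "(\<Sum>d\<in>D. char d) = of_nat (card D) * mat_trace (avg D)"
proof -
  have D': "\<And>a. a \<in> D \<Longrightarrow> a \<in> carrier G" using D subgroup.mem_carrier by fast
  have "mat_trace (avg D) = (\<Sum>a\<in>D. (1 / of_nat (card D)) * char a)"
    unfolding isotypic_def using D' 
    by (subst mat_trace_mat_sum)
      (auto simp: mat_trace_smult[of _ n] afforded_char_def intro!: sum.cong)
  then show ?thesis using card_subgroup_pos[OF D] by (simp add: sum_distrib_left)
qed

lemma sum_char_nat: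
  assumes D: "subgroup D G"
  shows "\<exists>k::nat. (\<Sum>d\<in>D. char d) = of_nat k"
proof -
  obtain m P Q where "P \<in> carrier_mat n m" "Q \<in> carrier_mat m n" "Q * P = 1\<^sub>m m" "P * Q = avg D"
    using idempotent_factorization[OF isotypic_carrier isotypic_idem[OF D linear_char_on_one[OF D]]] .
  then have "mat_trace (avg D) = of_nat m" using mat_trace_mult_comm[of P n m Q] by (simp add: mat_trace_one)
  then show ?thesis using sum_char_eq_trace_avg[OF D] by (metis of_nat_mult)
qed

end

section \<open>Common eigenvectors of commuting elements\<close>

lemma sum_cyclic_shift:
  fixes h :: "nat \<Rightarrow> complex"
  assumes "h k = h 0"
  shows "(\<Sum>j<k. h (Suc j)) = (\<Sum>j<k. h j)"
  using sum.lessThan_Suc_shift[of h k] sum.lessThan_Suc[of h k] assms by simp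

context finite_group_rep
begin

text \<open>The \<open>k\<close>-th power of \<open>\<rho> a\<close> is the identity for \<open>k = |G|\<close>, so multiples of the
  projections to its eigenspaces are given by Fourier sums of its powers over the \<open>k\<close>-th roots of unity. They add up to a multiple of the identity, so one of
  them does not kill \<open>X\<close>. Being polynomials in \<open>\<rho> a\<close>, they commute with whatever commutes
  with \<open>\<rho> a\<close>, which preserves the eigenspaces of other elements.\<close>

lemma eigenmatrix_exists:
  assumes a: "a \<in> carrier G" and X: "X \<in> carrier_mat n n" "X \<noteq> 0\<^sub>m n n"
  obtains Y c where "Y \<in> carrier_mat n n" "Y * X \<noteq> 0\<^sub>m n n" "\<rho> a * Y = c \<cdot>\<^sub>m Y"
    "\<And>B. B \<in> carrier_mat n n \<Longrightarrow> B * \<rho> a = \<rho> a * B \<Longrightarrow> B * Y = Y * B"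
proof -
  define k where "k = Coset.order G"
  have k: "k > 0" unfolding k_def using order_gt_0_iff_finite fin by blast
  have ak: "a [^] k = \<one>" unfolding k_def using pow_order_eq_1[OF a] .
  define z where "z = cis (2 * pi / k)"
  have zk: "z ^ k = 1" using k by (simp add: z_def DeMoivre)
  have zj: "z ^ j \<noteq> 1" if "0 < j" "j < k" for j
  proof
    assume "z ^ j = 1"
    then have eq: "cis (2 * pi * real j / real k) = cis (2 * pi * real 0 / real k)"
      by (simp add: z_def DeMoivre mult_ac)
    have "j \<in> {..<k}" "0 \<in> {..<k}" using that by auto
    then have "j = 0"
      using inj_onD[OF bij_betw_imp_inj_on[OF bij_betw_roots_unity[OF k]] eq] by blast
    then show False using that by blast
  qed
  \<comment> \<open>Up to the factor \<open>k\<close>, the spectral projection for the eigenvalue \<open>z ^ (- i)\<close>.\<close>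
  define E where "E i = mat_sum n (\<lambda>j. (z ^ (i * j)) \<cdot>\<^sub>m \<rho> (a [^] j)) {..<k}" for i
  have E: "E i \<in> carrier_mat n n" for i by (simp add: E_def)
  have eig: "\<rho> a * E i = inverse (z ^ i) \<cdot>\<^sub>m E i" for i
  proof -
    let ?g = "\<lambda>j. (z ^ (i * j)) \<cdot>\<^sub>m \<rho> (a [^] j)"
    have "\<rho> a * E i = mat_sum n (\<lambda>j. \<rho> a * ?g j) {..<k}"
      unfolding E_def using a by (subst mat_sum_mult_left) auto
    also have "\<dots> = mat_sum n (\<lambda>j. inverse (z ^ i) \<cdot>\<^sub>m ?g (Suc j)) {..<k}"
    proof (rule mat_sum_cong)
      fix j
      have "z \<noteq> 0" by (simp add: z_def)
      have "z ^ (i * Suc j) = z ^ i * z ^ (i * j)" by (simp add: power_add)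
      then have zz: "inverse (z ^ i) * z ^ (i * Suc j) = z ^ (i * j)"
        using \<open>z \<noteq> 0\<close> by (metis left_inverse mult.assoc mult_1 power_not_zero)
      have "\<rho> a * ?g j = (z ^ (i * j)) \<cdot>\<^sub>m (\<rho> a * \<rho> (a [^] j))"
        using a by (intro mult_smult_distrib[of _ n n _ n]) auto
      also have "\<rho> a * \<rho> (a [^] j) = \<rho> (a [^] Suc j)"
        using a by (metis nat_pow_Suc2 nat_pow_closed \<rho>_mult)
      finally show "\<rho> a * ?g j = inverse (z ^ i) \<cdot>\<^sub>m ?g (Suc j)"
        unfolding smult_smult_mat zz .
    qed
    also have "\<dots> = inverse (z ^ i) \<cdot>\<^sub>m mat_sum n (\<lambda>j. ?g (Suc j)) {..<k}"
      using a by (subst mat_sum_smult) auto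
    also have "mat_sum n (\<lambda>j. ?g (Suc j)) {..<k} = E i"
    proof -
      have "?g k = ?g 0" using ak zk by (simp add: mult.commute[of i] power_mult)
      then have "(\<Sum>j<k. ?g (Suc j) $$ (r,s)) = (\<Sum>j<k. ?g j $$ (r,s))" for r s
        by (intro sum_cyclic_shift[of "\<lambda>j. ?g j $$ (r,s)" k]) (rule arg_cong)
      then show ?thesis unfolding E_def mat_sum_def by simp
    qed
    finally show ?thesis .
  qed
  have comm: "B * E i = E i * B" if B: "B \<in> carrier_mat n n" "B * \<rho> a = \<rho> a * B" for B i
  proof -
    have pw: "B * \<rho> (a [^] j) = \<rho> (a [^] j) * B" for j :: nat
    proof (induction j)
      case (Suc j)
      have "B * \<rho> (a [^] Suc j) = B * \<rho> (a [^] j) * \<rho> a"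
        using a B by (simp add: \<rho>_mult mat_assoc)
      also have "\<dots> = \<rho> (a [^] j) * (B * \<rho> a)" using a B Suc by (simp add: mat_assoc)
      also have "\<dots> = \<rho> (a [^] Suc j) * B" using a B by (simp add: \<rho>_mult mat_assoc)
      finally show ?case .
    qed (use B in simp)
    show ?thesis
      unfolding E_def using a B
      by (subst mat_sum_mult_left, simp, simp, subst mat_sum_mult_right, simp, simp)
        (auto intro!: mat_sum_cong simp: mult_smult_distrib[of _ n n _ n] mult_smult_assoc_mat[of _ n n _ n] pw)
  qed
  have sumE: "mat_sum n E {..<k} = of_nat k \<cdot>\<^sub>m 1\<^sub>m n"
  proof -
    have "mat_sum n E {..<k} = mat_sum n (\<lambda>j. mat_sum n (\<lambda>i. (z ^ (i * j)) \<cdot>\<^sub>m \<rho> (a [^] j)) {..<k}) {..<k}"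
      unfolding E_def by (rule mat_sum_swap)
    also have "\<dots> = mat_sum n (\<lambda>j. (if j = 0 then of_nat k else 0) \<cdot>\<^sub>m 1\<^sub>m n) {..<k}"
    proof (rule mat_sum_cong)
      fix j assume j: "j \<in> {..<k}"
      have s: "(\<Sum>i<k. z ^ (i * j)) = (if j = 0 then of_nat k else 0)"
      proof (cases "j = 0")
        case False
        then have "z ^ j \<noteq> 1" using zj j by auto
        moreover have "(z ^ j) ^ k = 1" using zk by (metis mult.commute power_mult power_one)
        moreover have "(\<Sum>i<k. z ^ (i * j)) = (\<Sum>i<k. (z ^ j) ^ i)"
          by (simp add: power_mult[symmetric] mult.commute)
        ultimately show ?thesis using False geometric_sum[of "z ^ j" k] by simp
      qed simp
      show "mat_sum n (\<lambda>i. (z ^ (i * j)) \<cdot>\<^sub>m \<rho> (a [^] j)) {..<k}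
          = (if j = 0 then of_nat k else 0) \<cdot>\<^sub>m 1\<^sub>m n"
        using a by (subst mat_sum_smult_const) (simp_all add: s zero_smult_mat[of _ n n])
    qed
    also have "\<dots> = of_nat k \<cdot>\<^sub>m 1\<^sub>m n"
      using k by (subst mat_sum_smult_const) auto
    finally show ?thesis .
  qed
  have "\<exists>i<k. E i * X \<noteq> 0\<^sub>m n n"
  proof (rule ccontr)
    assume "\<not> ?thesis"
    then have "mat_sum n (\<lambda>i. E i * X) {..<k} = mat_sum n (\<lambda>i. 0 \<cdot>\<^sub>m 0\<^sub>m n n) {..<k}"
      by (intro mat_sum_cong) auto
    also have "\<dots> = 0\<^sub>m n n" by (subst mat_sum_smult_const) auto
    finally have "mat_sum n E {..<k} * X = 0\<^sub>m n n" using X E by (subst mat_sum_mult_right) auto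
    then have "of_nat k \<cdot>\<^sub>m X = 0\<^sub>m n n" using X sumE by (simp add: mult_smult_assoc_mat[of _ n n _ n])
    then have "(1 / of_nat k) \<cdot>\<^sub>m (of_nat k \<cdot>\<^sub>m X) = (1 / of_nat k :: complex) \<cdot>\<^sub>m 0\<^sub>m n n" by simp
    then show False using k X by (simp add: smult_smult_mat)
  qed
  then show ?thesis using that[OF E] eig comm by metis
qed

text \<open>The common eigenvectors are collected as columns of a nonzero matrix \<open>X\<close>. The inductive
  step multiplies \<open>X\<close> by a spectral projection of the new element.\<close>

lemma simultaneous_eigen:
  assumes "finite B" "B \<subseteq> carrier G" "\<And>a b. a \<in> B \<Longrightarrow> b \<in> B \<Longrightarrow> \<rho> a * \<rho> b = \<rho> b * \<rho> a"
  shows "\<exists>X l. X \<in> carrier_mat n n \<and> X \<noteq> 0\<^sub>m n n \<and> (\<forall>b\<in>B. \<rho> b * X = l b \<cdot>\<^sub>m X)"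
  using assms
proof (induction B rule: finite_induct)
  case empty
  have "(1\<^sub>m n :: complex mat) \<noteq> 0\<^sub>m n n"
    using degree_pos by (metis index_one_mat(1) index_zero_mat(1) one_neq_zero)
  then show ?case by (intro exI[of _ "1\<^sub>m n"]) auto
next
  case (insert a B)
  then obtain X l where X: "X \<in> carrier_mat n n" "X \<noteq> 0\<^sub>m n n" and l: "\<forall>b\<in>B. \<rho> b * X = l b \<cdot>\<^sub>m X"
    by auto
  have a: "a \<in> carrier G" using insert by auto
  obtain Y c where Y: "Y \<in> carrier_mat n n" "Y * X \<noteq> 0\<^sub>m n n" "\<rho> a * Y = c \<cdot>\<^sub>m Y"
    and comm: "\<And>B. B \<in> carrier_mat n n \<Longrightarrow> B * \<rho> a = \<rho> a * B \<Longrightarrow> B * Y = Y * B"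
    using eigenmatrix_exists[OF a X] by blast
  have "\<rho> b * (Y * X) = l b \<cdot>\<^sub>m (Y * X)" if b: "b \<in> B" for b
  proof -
    have b': "b \<in> carrier G" using b insert by auto
    have "\<rho> b * Y = Y * \<rho> b" using comm[of "\<rho> b"] insert.prems b b' by auto
    then have "\<rho> b * (Y * X) = Y * (\<rho> b * X)" using b' X Y by (simp flip: mat_assoc)
    then show ?thesis using l b X Y by (simp add: mult_smult_distrib[of _ n n _ n])
  qed
  moreover have "\<rho> a * (Y * X) = c \<cdot>\<^sub>m (Y * X)"
    using a X Y by (simp add: mult_smult_assoc_mat[of _ n n _ n] flip: mat_assoc)
  ultimately show ?case using X Y \<open>a \<notin> B\<close>
    by (intro exI[of _ "Y * X"] exI[of _ "l(a := c)"]) auto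
qed

end

section \<open>Irreducible representations\<close>

locale irreducible_rep = finite_group_rep +
  assumes irr: "irreducible_representation G n \<rho>"
begin

text \<open>The form of Schur's lemma that is needed: the fixed vectors of \<open>e\<close> are an invariant subspace.\<close>

lemma commuting_idempotent:
  assumes e: "e \<in> carrier_mat n n" and idem: "e * e = e"
    and comm: "\<And>g. g \<in> carrier G \<Longrightarrow> \<rho> g * e = e * \<rho> g"
  shows "e = 0\<^sub>m n n \<or> e = 1\<^sub>m n"
proof -
  define W where "W = {w \<in> carrier_vec n. e *\<^sub>v w = w}"
  have "VectorSpace.subspace class_ring W (module_vec TYPE(complex) n)"
    unfolding VectorSpace.subspace_def submodule_def
    using e vec_vs vec_module
    by (auto simp: W_def module_vec_simps mult_add_distrib_mat_vec[of _ n n] mult_mat_vec[of _ n n])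
  moreover have "\<rho> g *\<^sub>v w \<in> W" if g: "g \<in> carrier G" and w: "w \<in> W" for g w
  proof -
    have w': "w \<in> carrier_vec n" "e *\<^sub>v w = w" using w by (auto simp: W_def)
    have "e *\<^sub>v (\<rho> g *\<^sub>v w) = (e * \<rho> g) *\<^sub>v w" using g w' e by (simp add: assoc_mult_mat_vec[of _ n n _ n])
    also have "\<dots> = \<rho> g *\<^sub>v (e *\<^sub>v w)" using g w'(1) e comm[OF g, symmetric]
      by (simp add: assoc_mult_mat_vec[of _ n n _ n])
    finally show ?thesis using w' mult_mat_vec_carrier[OF \<rho>_carrier[OF g] w'(1)] by (simp add: W_def)
  qed
  ultimately consider "W = {0\<^sub>v n}" | "W = carrier_vec n"
    using irr unfolding irreducible_representation_def by blast
  then show ?thesis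
  proof cases
    case 1
    have "e *\<^sub>v v = 0\<^sub>m n n *\<^sub>v v" if v: "v \<in> carrier_vec n" for v
    proof -
      have "e *\<^sub>v (e *\<^sub>v v) = e *\<^sub>v v" using e v idem by (simp flip: assoc_mult_mat_vec[of _ n n _ n])
      then have "e *\<^sub>v v \<in> W" using e v by (simp add: W_def)
      then show ?thesis using 1 v by (auto intro!: eq_vecI)
    qed
    then have "e = 0\<^sub>m n n" using e by (intro mat_eq_if_mult_vec_eq[of _ n]) auto
    then show ?thesis ..
  next
    case 2
    have "e *\<^sub>v v = 1\<^sub>m n *\<^sub>v v" if v: "v \<in> carrier_vec n" for v
      using v 2 unfolding W_def by auto
    then have "e = 1\<^sub>m n" using e by (intro mat_eq_if_mult_vec_eq[of _ n]) auto
    then show ?thesis ..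
  qed
qed

text \<open>A nonzero sum means that the normal subgroup \<open>D\<close> has a nonzero fixed vector. The fixed
  space of a normal subgroup is invariant, so by irreducibility it is the whole space.\<close>

lemma normal_in_kernel:
  assumes D: "D \<lhd> G" and ne: "(\<Sum>d\<in>D. char d) \<noteq> 0" and d: "d \<in> D"
  shows "\<rho> d = 1\<^sub>m n"
proof -
  have sub: "subgroup D G" using D by (rule normal_imp_subgroup)
  have d': "d \<in> carrier G" using sub d subgroup.mem_carrier by fast
  have "avg D = 1\<^sub>m n"
  proof -
    have "avg D \<noteq> 0\<^sub>m n n" using ne sum_char_eq_trace_avg[OF sub] by (auto simp: mat_trace_zero)
    then show ?thesis
      using commuting_idempotent[OF isotypic_carrier isotypic_idem[OF sub linear_char_on_one[OF sub]]]
        avg_commutes[OF D] by blast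
  qed
  then show ?thesis
    using isotypic_absorb(1)[OF sub linear_char_on_one[OF sub] d] right_mult_one_mat[OF \<rho>_carrier[OF d']]
    by simp
qed

text \<open>The projection to the first coordinate commutes with all scalar matrices, so by
  irreducibility it is \<open>0\<close> or \<open>1\<close>, which needs a one-dimensional space.\<close>

lemma degree_one_if_scalar:
  assumes "\<And>g. g \<in> carrier G \<Longrightarrow> \<exists>c. \<rho> g = c \<cdot>\<^sub>m 1\<^sub>m n"
  shows "n = 1"
proof (rule ccontr)
  assume "n \<noteq> 1"
  then have n: "1 < n" using degree_pos by simp
  define e :: "complex mat" where "e = mat n n (\<lambda>(i,j). if i = 0 \<and> j = 0 then 1 else 0)"
  have e: "e \<in> carrier_mat n n" by (simp add: e_def)
  have "e * e = e"
    using n by (intro eq_matI) (auto simp: e_def scalar_prod_def atLeast0LessThan if_distrib sum.If_cases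
       intro!: sum.neutral)
  moreover have "\<rho> g * e = e * \<rho> g" if "g \<in> carrier G" for g
    using assms[OF that] e by (auto simp: mult_smult_distrib[of _ n n _ n] mult_smult_assoc_mat[of _ n n _ n])
  ultimately have "e = 0\<^sub>m n n \<or> e = 1\<^sub>m n" using commuting_idempotent[OF e] by blast
  moreover have "e $$ (0,0) = 1" "e $$ (1,1) = 0" using n by (simp_all add: e_def)
  ultimately show False using n by auto
qed

end

section \<open>Abelian normal subgroups in primitive representations\<close>

context irreducible_rep
begin

text \<open>This is Clifford's theorem. Let \<open>e\<close> project to a nonzero common eigenspace of \<open>A\<close>, with
  eigenvalues \<open>l\<close>. The conjugates of \<open>e\<close> under \<open>G\<close> are projections to the eigenspaces of
  the conjugates of \<open>l\<close>. Two of them are equal or annihilate each other, and their sum is the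
  identity because it is a nonzero idempotent that commutes with \<open>G\<close>. So the space is the direct sum of eigenspaces permuted by
  \<open>G\<close>, and the character is induced from the action \<open>\<sigma>\<close> of the stabilizer \<open>T\<close> on the image
  of \<open>e\<close>. Primitivity forces \<open>T = G\<close>, so \<open>e = 1\<close> and \<open>A\<close> acts by the scalars \<open>l\<close>.\<close>

lemma abelian_normal_scalar:
  assumes prim: "primitive_char G char" and A: "A \<lhd> G"
    and comm: "\<And>a b. a \<in> A \<Longrightarrow> b \<in> A \<Longrightarrow> \<rho> a * \<rho> b = \<rho> b * \<rho> a"
    and a: "a \<in> A"
  shows "\<exists>c. \<rho> a = c \<cdot>\<^sub>m 1\<^sub>m n"
proof -
  have A_sub: "subgroup A G" using A by (rule normal_imp_subgroup)
  interpret A: normal A G by fact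
  have A': "\<And>a. a \<in> A \<Longrightarrow> a \<in> carrier G" using A_sub subgroup.mem_carrier by fast
  have finA: "finite A" using finite_subset[OF A.subset fin] .
  obtain X l where X: "X \<in> carrier_mat n n" "X \<noteq> 0\<^sub>m n n" and eig: "\<And>b. b \<in> A \<Longrightarrow> \<rho> b * X = l b \<cdot>\<^sub>m X"
    using simultaneous_eigen[OF finA A.subset comm] by blast
  obtain r s where rs: "r < n" "s < n" "X $$ (r,s) \<noteq> 0"
    using X by (metis carrier_matD eq_matI index_zero_mat)
  have smult_cancel: "c = d" if "c \<cdot>\<^sub>m X = d \<cdot>\<^sub>m X" for c d
  proof -
    have "(c \<cdot>\<^sub>m X) $$ (r,s) = (d \<cdot>\<^sub>m X) $$ (r,s)" using that by simp
    then show ?thesis using rs X by simp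
  qed
  have l_mult: "l (x \<otimes> y) = l x * l y" if xy: "x \<in> A" "y \<in> A" for x y
  proof (rule smult_cancel)
    have "l (x \<otimes> y) \<cdot>\<^sub>m X = \<rho> x * (\<rho> y * X)" using xy eig[of "x \<otimes> y"] A' X by (simp add: \<rho>_mult mat_assoc)
    also have "\<dots> = l y \<cdot>\<^sub>m (l x \<cdot>\<^sub>m X)" using xy eig A' X by (simp add: mult_smult_distrib[of _ n n _ n])
    finally show "l (x \<otimes> y) \<cdot>\<^sub>m X = (l x * l y) \<cdot>\<^sub>m X" by (simp add: smult_smult_mat mult.commute)
  qed
  have l_one: "l \<one> = 1" by (rule smult_cancel) (use eig[of \<one>] X in simp)
  have l: "linear_char_on A l"
    unfolding linear_char_on_def
  proof (intro conjI ballI)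
    fix x assume x: "x \<in> A"
    then have "l x * l (inv x) = 1" using l_mult[of x "inv x"] A' l_one by simp
    then show "l x \<noteq> 0" by auto
  qed (rule l_mult)
  define e where "e = isotypic A l"
  have e: "e \<in> carrier_mat n n" by (simp add: e_def)
  have ee: "e * e = e" unfolding e_def by (rule isotypic_idem[OF A_sub l])
  have e0: "e \<noteq> 0\<^sub>m n n" using isotypic_fixes[OF A_sub l X(1) eig] X by (auto simp: e_def)
  \<comment> \<open>The commutant of \<open>e\<close> is the stabilizer of \<open>l\<close>, since \<open>l\<close> and \<open>e\<close> determine each other.\<close>
  define T where "T = {g \<in> carrier G. \<rho> g * e = e * \<rho> g}"
  define c where "c g = \<rho> g * e * \<rho> (inv g)" for g
  have c: "c g \<in> carrier_mat n n" if "g \<in> carrier G" for g using that e by (simp add: c_def)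
  have c\<rho>: "c g * \<rho> g = \<rho> g * e" if g: "g \<in> carrier G" for g
    using g e by (simp add: c_def mat_assoc \<rho>_inv)
  have T_iff: "g \<in> T \<longleftrightarrow> c g = e" if g: "g \<in> carrier G" for g
  proof
    assume "g \<in> T"
    then have "c g = e * (\<rho> g * \<rho> (inv g))" using g e by (simp add: c_def T_def mat_assoc)
    then show "c g = e" using g e by (simp add: \<rho>_inv)
  next
    assume "c g = e"
    then show "g \<in> T" using c\<rho>[OF g] g by (simp add: T_def)
  qed
  have ec: "e * c g = (if g \<in> T then e else 0\<^sub>m n n)" if g: "g \<in> carrier G" for g
  proof (cases "g \<in> T")
    case False
    let ?m = "\<lambda>a. l (inv g \<otimes> a \<otimes> g)"
    have cm: "c g = isotypic A ?m" unfolding c_def e_def by (rule isotypic_conj[OF A g])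
    have m: "linear_char_on A ?m"
      unfolding linear_char_on_def
    proof (intro conjI ballI)
      fix x y assume xy: "x \<in> A" "y \<in> A"
      have "inv g \<otimes> (x \<otimes> y) \<otimes> g = (inv g \<otimes> x \<otimes> g) \<otimes> (inv g \<otimes> y \<otimes> g)"
        using xy A' g by (simp add: m_assoc r_inv_cancel)
      then show "?m (x \<otimes> y) = ?m x * ?m y" using xy g l A.inv_op_closed1 by (simp add: linear_char_on_def)
    qed (use l g A.inv_op_closed1 in \<open>auto simp: linear_char_on_def\<close>)
    obtain x where x: "x \<in> A" "l x \<noteq> ?m x"
      using False T_iff[OF g] cm isotypic_cong[of A ?m l] unfolding e_def by metis
    have "\<rho> x * c g = ?m x \<cdot>\<^sub>m c g" unfolding cm by (rule isotypic_absorb(1)[OF A_sub m x(1)])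
    then have "e * c g = 0\<^sub>m n n" unfolding e_def by (rule isotypic_kills[OF A_sub l c[OF g] x(1) _ x(2)])
    then show ?thesis using False by simp
  qed (use T_iff[OF g] ee in simp)
  have T: "subgroup T G"
    unfolding T_def using e by (rule commutant_subgroup)
  have cardT: "card T \<noteq> 0" using card_subgroup_pos[OF T] by simp
  \<comment> \<open>Summing over all of \<open>G\<close> counts each conjugate of \<open>e\<close> exactly \<open>card T\<close> times.\<close>
  define S where "S = mat_sum n c (carrier G)"
  have S: "S \<in> carrier_mat n n" by (simp add: S_def)
  have eS: "e * S = of_nat (card T) \<cdot>\<^sub>m e"
  proof -
    have "e * S = mat_sum n (\<lambda>g. e * c g) (carrier G)"
      unfolding S_def using e c by (intro mat_sum_mult_left) auto
    also have "\<dots> = mat_sum n (\<lambda>g. (if g \<in> T then 1 else 0) \<cdot>\<^sub>m e) (carrier G)"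
      using ec e by (intro mat_sum_cong) auto
    also have "\<dots> = (\<Sum>g\<in>carrier G. if g \<in> T then 1 else 0) \<cdot>\<^sub>m e"
      using e by (rule mat_sum_smult_const)
    also have "(\<Sum>g\<in>carrier G. if g \<in> T then 1 else 0) = (of_nat (card T) :: complex)"
      using fin subgroup.subset[OF T] by (simp add: sum.If_cases Int_absorb1)
    finally show ?thesis .
  qed
  have S_comm: "\<rho> g * S = S * \<rho> g" if g: "g \<in> carrier G" for g
  proof -
    have bij: "bij_betw (\<lambda>x. g \<otimes> x) (carrier G) (carrier G)"
      by (rule bij_betw_byWitness[of _ "\<lambda>x. inv g \<otimes> x"]) (use g in \<open>auto simp: r_inv_cancel l_inv_cancel\<close>)
    have "\<rho> g * S = mat_sum n (\<lambda>x. \<rho> g * c x) (carrier G)"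
      unfolding S_def using g c by (intro mat_sum_mult_left) auto
    also have "\<dots> = mat_sum n (\<lambda>x. c (g \<otimes> x) * \<rho> g) (carrier G)"
    proof (rule mat_sum_cong)
      fix x assume x: "x \<in> carrier G"
      have "c (g \<otimes> x) * \<rho> g = \<rho> (g \<otimes> x) * e * (\<rho> (inv (g \<otimes> x)) * \<rho> g)"
        using g x e by (simp add: c_def mat_assoc)
      also have "\<rho> (inv (g \<otimes> x)) * \<rho> g = \<rho> (inv x)"
        using g x by (simp add: inv_mult_group m_assoc flip: \<rho>_mult)
      finally show "\<rho> g * c x = c (g \<otimes> x) * \<rho> g"
        using g x e by (simp add: c_def \<rho>_mult mat_assoc)
    qed
    also have "\<dots> = mat_sum n (\<lambda>x. c x * \<rho> g) (carrier G)"
      by (rule mat_sum_reindex_bij_betw[OF bij])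
    also have "\<dots> = S * \<rho> g"
      unfolding S_def using g c by (intro mat_sum_mult_right[symmetric]) auto
    finally show ?thesis .
  qed
  have cS: "c g * S = of_nat (card T) \<cdot>\<^sub>m c g" if g: "g \<in> carrier G" for g
  proof -
    have "c g * S = \<rho> g * e * (\<rho> (inv g) * S)" using g e S by (simp add: c_def mat_assoc)
    also have "\<dots> = \<rho> g * (e * S) * \<rho> (inv g)" using g e S S_comm[of "inv g"] by (simp add: mat_assoc)
    also have "\<dots> = of_nat (card T) \<cdot>\<^sub>m c g"
      using g e by (simp add: eS c_def mult_smult_distrib[of _ n n _ n] mult_smult_assoc_mat[of _ n n _ n])
    finally show ?thesis .
  qed
  have SS: "S * S = of_nat (card T) \<cdot>\<^sub>m S"
  proof -
    have "S * S = mat_sum n (\<lambda>g. c g * S) (carrier G)"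
      using c S by (subst (1) S_def, intro mat_sum_mult_right) auto
    also have "\<dots> = mat_sum n (\<lambda>g. of_nat (card T) \<cdot>\<^sub>m c g) (carrier G)"
      using cS by (rule mat_sum_cong)
    also have "\<dots> = of_nat (card T) \<cdot>\<^sub>m S"
      unfolding S_def using c by (intro mat_sum_smult[symmetric]) auto
    finally show ?thesis .
  qed
  define E where "E = (1 / of_nat (card T)) \<cdot>\<^sub>m S"
  have E: "E \<in> carrier_mat n n" using S by (simp add: E_def)
  have E1: "E = 1\<^sub>m n"
  proof -
    have "E * E = E" using S cardT
      by (simp add: E_def SS mult_smult_distrib[of _ n n _ n] mult_smult_assoc_mat[of _ n n _ n] smult_smult_mat)
    moreover have "\<rho> g * E = E * \<rho> g" if "g \<in> carrier G" for g
      using that S S_comm by (simp add: E_def mult_smult_distrib[of _ n n _ n] mult_smult_assoc_mat[of _ n n _ n])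
    moreover have "E \<noteq> 0\<^sub>m n n"
    proof
      assume "E = 0\<^sub>m n n"
      then have "e * E = 0\<^sub>m n n" using e by simp
      moreover have "e * E = e"
        using e S cardT by (simp add: E_def eS mult_smult_distrib[of _ n n _ n] smult_smult_mat)
      ultimately show False using e0 by simp
    qed
    ultimately show ?thesis using commuting_idempotent[OF E] by blast
  qed
  obtain m P Q where P: "P \<in> carrier_mat n m" and Q: "Q \<in> carrier_mat m n"
    and QP: "Q * P = 1\<^sub>m m" and PQ: "P * Q = e"
    using idempotent_factorization[OF e ee] .
  have m: "0 < m"
  proof (rule ccontr)
    assume "\<not> 0 < m"
    then have "e = 0\<^sub>m n n" using P Q unfolding PQ[symmetric] by (intro eq_matI) (auto simp: scalar_prod_def)
    then show False using e0 by simp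
  qed
  have eP: "e * P = P" using PQ QP P Q assoc_mult_mat[OF P Q P] by simp
  define \<sigma> where "\<sigma> t = Q * \<rho> t * P" for t
  have tr_\<sigma>: "mat_trace (\<sigma> t) = mat_trace (\<rho> t * e)" if t: "t \<in> carrier G" for t
  proof -
    have "mat_trace (\<sigma> t) = mat_trace (Q * (\<rho> t * P))"
      using P Q t by (simp add: \<sigma>_def assoc_mult_mat[of _ m n _ n _ m])
    also have "\<dots> = mat_trace (\<rho> t * P * Q)"
      using P Q t by (intro mat_trace_mult_comm[of _ m n] mult_carrier_mat[of _ n n]) auto
    also have "\<dots> = mat_trace (\<rho> t * e)"
      using P Q t PQ by (simp add: assoc_mult_mat[of _ n n _ m _ n])
    finally show ?thesis .
  qed
  interpret TG: group "G\<lparr>carrier := T\<rparr>" using subgroup_imp_group[OF T] .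
  have rep_\<sigma>: "representation (G\<lparr>carrier := T\<rparr>) m \<sigma>"
  proof -
    have "\<sigma> (x \<otimes> y) = \<sigma> x * \<sigma> y" if "x \<in> T" "y \<in> T" for x y
    proof -
      have x: "x \<in> carrier G" and y: "y \<in> carrier G" and ye: "\<rho> y * e = e * \<rho> y"
        using that by (auto simp: T_def)
      have yP: "\<rho> y * P \<in> carrier_mat n m" and xP: "\<rho> x * P \<in> carrier_mat n m"
        using x y P mult_carrier_mat by (metis \<rho>_carrier)+
      have "\<sigma> x * \<sigma> y = (Q * (\<rho> x * P)) * (Q * (\<rho> y * P))"
        using P Q x y by (simp add: \<sigma>_def assoc_mult_mat[of _ m n _ n _ m])
      also have "\<dots> = Q * ((\<rho> x * P) * (Q * (\<rho> y * P)))"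
        using Q xP yP mult_carrier_mat[OF Q yP] by (intro assoc_mult_mat[of _ m n _ m _ m]) auto
      also have "(\<rho> x * P) * (Q * (\<rho> y * P)) = \<rho> x * (P * (Q * (\<rho> y * P)))"
        using P Q x mult_carrier_mat[OF Q yP] by (intro assoc_mult_mat[of _ n n _ m _ m]) auto
      also have "P * (Q * (\<rho> y * P)) = e * (\<rho> y * P)"
        using assoc_mult_mat[OF P Q yP] PQ by simp
      also have "\<dots> = \<rho> y * (e * P)"
        using e y P ye by (simp flip: assoc_mult_mat[of _ n n _ n _ m])
      also have "\<dots> = \<rho> y * P" by (simp add: eP)
      also have "\<rho> x * (\<rho> y * P) = \<rho> (x \<otimes> y) * P"
        using x y P by (simp add: \<rho>_mult assoc_mult_mat[of _ n n _ n _ m])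
      also have "Q * (\<rho> (x \<otimes> y) * P) = \<sigma> (x \<otimes> y)"
        using P Q x y by (simp add: \<sigma>_def assoc_mult_mat[of _ m n _ n _ m])
      finally show ?thesis by simp
    qed
    moreover have "\<sigma> x \<in> carrier_mat m m" if "x \<in> T" for x
      using that P Q unfolding \<sigma>_def T_def by (auto intro!: mult_carrier_mat[of _ m n])
    moreover have "\<sigma> \<one> = 1\<^sub>m m" using P Q QP by (simp add: \<sigma>_def)
    ultimately show ?thesis using m unfolding representation_iff[OF TG.group_axioms] by auto
  qed
  define \<eta> where "\<eta> = afforded_char (G\<lparr>carrier := T\<rparr>) \<sigma>"
  have \<eta>: "\<eta> \<in> characters (G\<lparr>carrier := T\<rparr>)"
    using rep_\<sigma> unfolding \<eta>_def characters_def by blast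
  have tr_e: "mat_trace (\<rho> z * e) = (if z \<in> T then \<eta> z else 0)" if z: "z \<in> carrier G" for z
  proof (cases "z \<in> T")
    case True
    then show ?thesis using tr_\<sigma>[OF z] by (simp add: \<eta>_def afforded_char_def)
  next
    case False
    have "mat_trace (\<rho> z * e) = mat_trace ((\<rho> z * e) * e)" using z e ee by (simp add: mat_assoc)
    also have "\<dots> = mat_trace (e * (\<rho> z * e))" using z e by (intro mat_trace_mult_comm[of _ n n]) auto
    \<comment> \<open>The element \<open>z\<close> moves the image of \<open>e\<close> to a different eigenspace.\<close>
    also have "e * (\<rho> z * e) = (e * c z) * \<rho> z" using z e c by (simp add: mat_assoc c\<rho>)
    also have "\<dots> = 0\<^sub>m n n" using ec[OF z] False left_mult_zero_mat[OF \<rho>_carrier[OF z]] by simp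
    finally show ?thesis using False by (simp add: mat_trace_zero)
  qed
  have "induced_char G T \<eta> = char"
  proof
    fix g
    show "induced_char G T \<eta> g = char g"
    proof (cases "g \<in> carrier G")
      case g: True
      have bij: "bij_betw (\<lambda>x. inv x) (carrier G) (carrier G)"
      proof (rule bij_betw_byWitness[of _ "\<lambda>x. inv x"])
        show "(\<lambda>x. inv x) ` carrier G \<subseteq> carrier G" by blast
        then show "(\<lambda>x. inv x) ` carrier G \<subseteq> carrier G" .
      qed simp_all
      \<comment> \<open>Writing \<open>1\<close> as the normalized sum of the conjugates of \<open>e\<close> turns the trace into the
        induction formula.\<close>
      have "char g = mat_trace (\<rho> g * E)"
        using g E1 right_mult_one_mat[OF \<rho>_carrier[OF g]] by (simp add: afforded_char_def)
      also have "\<rho> g * E = mat_sum n (\<lambda>x. (1 / of_nat (card T)) \<cdot>\<^sub>m (\<rho> g * c x)) (carrier G)"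
      proof -
        have "\<rho> g * E = (1 / of_nat (card T)) \<cdot>\<^sub>m (\<rho> g * S)"
          unfolding E_def using g S by (intro mult_smult_distrib[of _ n n _ n]) auto
        also have "\<rho> g * S = mat_sum n (\<lambda>x. \<rho> g * c x) (carrier G)"
          unfolding S_def using g c by (intro mat_sum_mult_left) auto
        also have "(1 / of_nat (card T)) \<cdot>\<^sub>m \<dots> =
            mat_sum n (\<lambda>x. (1 / of_nat (card T)) \<cdot>\<^sub>m (\<rho> g * c x)) (carrier G)"
          using g c by (intro mat_sum_smult) auto
        finally show ?thesis .
      qed
      also have "mat_trace \<dots> = (\<Sum>x\<in>carrier G. mat_trace (\<rho> g * c x) / of_nat (card T))"
        using g c by (subst mat_trace_mat_sum) (auto simp: mat_trace_smult[of _ n])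
      also have "\<dots> = (\<Sum>x\<in>carrier G. mat_trace (\<rho> g * c (inv x)) / of_nat (card T))"
        by (rule sum.reindex_bij_betw[OF bij, symmetric])
      also have "\<dots> = (\<Sum>x\<in>carrier G. (if x \<otimes> g \<otimes> inv x \<in> T then \<eta> (x \<otimes> g \<otimes> inv x) else 0) / of_nat (card T))"
      proof (rule sum.cong[OF refl])
        fix x assume x: "x \<in> carrier G"
        have "mat_trace (\<rho> g * c (inv x)) = mat_trace ((\<rho> g * \<rho> (inv x) * e) * \<rho> x)"
          using g x e by (simp add: c_def mat_assoc)
        also have "\<dots> = mat_trace (\<rho> x * (\<rho> g * \<rho> (inv x) * e))"
          using g x e by (intro mat_trace_mult_comm[of _ n n]) auto
        also have "\<rho> x * (\<rho> g * \<rho> (inv x) * e) = \<rho> (x \<otimes> g \<otimes> inv x) * e"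
          using g x e by (simp add: \<rho>_mult mat_assoc)
        finally show "mat_trace (\<rho> g * c (inv x)) / of_nat (card T) =
          (if x \<otimes> g \<otimes> inv x \<in> T then \<eta> (x \<otimes> g \<otimes> inv x) else 0) / of_nat (card T)"
          using tr_e[of "x \<otimes> g \<otimes> inv x"] g x by simp
      qed
      also have "\<dots> = induced_char G T \<eta> g"
        using g by (simp add: induced_char_def sum_divide_distrib)
      finally show ?thesis by simp
    qed (simp add: induced_char_def afforded_char_def)
  qed
  then have "T = carrier G" using prim T \<eta> unfolding primitive_char_def by blast
  then have "\<rho> g * e = e * \<rho> g" if "g \<in> carrier G" for g using that by (auto simp: T_def)
  then have "e = 1\<^sub>m n" using commuting_idempotent[OF e ee] e0 by blast
  then have "\<rho> a = l a \<cdot>\<^sub>m 1\<^sub>m n"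
    using isotypic_absorb(1)[OF A_sub l a] right_mult_one_mat[OF \<rho>_carrier[OF A'[OF a]]]
    unfolding e_def[symmetric] by simp
  then show ?thesis ..
qed

text \<open>Modulo the kernel, \<open>G'\<close> is an abelian normal subgroup, so it acts by scalars. Then
  for every \<open>x\<close> the subgroup generated by \<open>G'\<close> and \<open>x\<close> also acts commutatively. It is normal
  since it contains \<open>G'\<close>, so \<open>x\<close> acts by a scalar as well.\<close>

lemma primitive_metabelian_degree_one:
  assumes prim: "primitive_char G char"
    and ker: "\<And>d. d \<in> derived G (derived G (carrier G)) \<Longrightarrow> \<rho> d = 1\<^sub>m n"
  shows "n = 1"
proof (rule degree_one_if_scalar)
  let ?D = "derived G (carrier G)"
  have D: "?D \<lhd> G" by (rule derived_self_is_normal)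
  then interpret D: normal ?D G .
  have comm_D: "\<rho> a * \<rho> b = \<rho> b * \<rho> a" if ab: "a \<in> ?D" "b \<in> ?D" for a b
  proof -
    have a: "a \<in> carrier G" and b: "b \<in> carrier G" using ab by auto
    let ?k = "a \<otimes> b \<otimes> inv a \<otimes> inv b"
    have "?k \<in> derived G ?D" unfolding derived_def[of G ?D] using ab by (auto intro!: generate.incl)
    then have "\<rho> ?k = 1\<^sub>m n" by (rule ker)
    moreover have "a \<otimes> b = ?k \<otimes> (b \<otimes> a)" using a b by (simp add: m_assoc l_inv_cancel)
    then have "\<rho> (a \<otimes> b) = \<rho> ?k * \<rho> (b \<otimes> a)" using a b by (metis \<rho>_mult inv_closed m_closed)
    ultimately have "\<rho> (a \<otimes> b) = \<rho> (b \<otimes> a)"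
      using left_mult_one_mat[OF \<rho>_carrier[of "b \<otimes> a"]] a b by simp
    then show ?thesis by (simp only: \<rho>_mult a b)
  qed
  have scal_D: "\<exists>c. \<rho> d = c \<cdot>\<^sub>m 1\<^sub>m n" if "d \<in> ?D" for d
    using abelian_normal_scalar[OF prim D comm_D that] .
  fix x assume x: "x \<in> carrier G"
  let ?S = "insert x ?D"
  have S: "?S \<subseteq> carrier G" using x D.subset by blast
  have scal_comm: "\<rho> d * \<rho> b = \<rho> b * \<rho> d" if d: "d \<in> ?D" and b: "b \<in> carrier G" for d b
  proof -
    obtain c where c: "\<rho> d = c \<cdot>\<^sub>m 1\<^sub>m n" using scal_D[OF d] ..
    have "\<rho> d * \<rho> b = c \<cdot>\<^sub>m \<rho> b" "\<rho> b * \<rho> d = c \<cdot>\<^sub>m \<rho> b"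
      unfolding c using mult_smult_assoc_mat[OF one_carrier_mat \<rho>_carrier[OF b]]
        mult_smult_distrib[OF \<rho>_carrier[OF b] one_carrier_mat]
        left_mult_one_mat[OF \<rho>_carrier[OF b]] right_mult_one_mat[OF \<rho>_carrier[OF b]] by simp_all
    then show ?thesis by simp
  qed
  have "\<rho> a * \<rho> b = \<rho> b * \<rho> a" if ab: "a \<in> ?S" "b \<in> ?S" for a b
  proof -
    have "a \<in> carrier G" "b \<in> carrier G" using ab S by blast+
    then show ?thesis using ab scal_comm[of a b] scal_comm[of b a] by fastforce
  qed
  then have comm: "\<rho> a * \<rho> b = \<rho> b * \<rho> a" if "a \<in> generate G ?S" "b \<in> generate G ?S" for a b
    using commute_on_generate[OF S] that by blast
  have A: "generate G ?S \<lhd> G"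
  proof (rule normal_invI)
    show sub: "subgroup (generate G ?S) G" using generate_is_subgroup[OF S] .
    fix g a assume g: "g \<in> carrier G" and a: "a \<in> generate G ?S"
    have a': "a \<in> carrier G" using generate_in_carrier[OF S a] .
    have "g \<otimes> a \<otimes> inv g \<otimes> inv a \<in> ?D" unfolding derived_def using g a' by (auto intro!: generate.incl)
    then have "g \<otimes> a \<otimes> inv g \<otimes> inv a \<in> generate G ?S" by (auto intro: generate.incl)
    then have "g \<otimes> a \<otimes> inv g \<otimes> inv a \<otimes> a \<in> generate G ?S" using sub a by (simp add: subgroup.m_closed)
    then show "g \<otimes> a \<otimes> inv g \<in> generate G ?S" using g a' by (simp add: m_assoc)
  qed
  show "\<exists>c. \<rho> x = c \<cdot>\<^sub>m 1\<^sub>m n"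
    by (rule abelian_normal_scalar[OF prim A comm]) (auto intro: generate.incl)
qed

end

section \<open>Sums of characters over normal subgroups\<close>

lemma linear_char_trivial_on_derived:
  assumes "group G" "\<mu> \<in> linear_characters G" "x \<in> derived G (carrier G)"
  shows "\<mu> x = 1"
proof -
  interpret group G by fact
  obtain n \<rho> where rep: "representation G n \<rho>" and \<mu>: "\<mu> = afforded_char G \<rho>" and \<mu>1: "\<mu> \<one>\<^bsub>G\<^esub> = 1"
    using assms(2) unfolding linear_characters_def characters_def by blast
  note R = rep[unfolded representation_iff[OF \<open>group G\<close>]]
  have n: "n = 1" using \<mu>1 R by (simp add: \<mu> afforded_char_def mat_trace_one)
  have \<mu>_eq: "\<mu> g = \<rho> g $$ (0,0)" if "g \<in> carrier G" for g
    using that R n by (auto simp: \<mu> afforded_char_def mat_trace_def)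
  have mult: "\<mu> (g \<otimes>\<^bsub>G\<^esub> h) = \<mu> g * \<mu> h" if "g \<in> carrier G" "h \<in> carrier G" for g h
  proof -
    have "\<rho> g \<in> carrier_mat 1 1" "\<rho> h \<in> carrier_mat 1 1" "\<rho> (g \<otimes>\<^bsub>G\<^esub> h) = \<rho> g * \<rho> h" using that R n by auto
    then show ?thesis using that by (simp add: \<mu>_eq scalar_prod_def)
  qed
  have inv: "\<mu> g * \<mu> (inv\<^bsub>G\<^esub> g) = 1" if "g \<in> carrier G" for g
    using that \<mu>1 by (simp flip: mult)
  have "subgroup {g \<in> carrier G. \<mu> g = 1} G"
  proof (rule subgroupI)
    fix g assume "g \<in> {g \<in> carrier G. \<mu> g = 1}"
    then show "inv\<^bsub>G\<^esub> g \<in> {g \<in> carrier G. \<mu> g = 1}" using inv[of g] by auto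
  qed (use \<mu>1 mult in auto)
  moreover have "derived_set G (carrier G) \<subseteq> {g \<in> carrier G. \<mu> g = 1}"
  proof -
    have "\<mu> (g \<otimes>\<^bsub>G\<^esub> h \<otimes>\<^bsub>G\<^esub> inv\<^bsub>G\<^esub> g \<otimes>\<^bsub>G\<^esub> inv\<^bsub>G\<^esub> h) = 1" if gh: "g \<in> carrier G" "h \<in> carrier G" for g h
    proof -
      have "\<mu> (g \<otimes>\<^bsub>G\<^esub> h \<otimes>\<^bsub>G\<^esub> inv\<^bsub>G\<^esub> g \<otimes>\<^bsub>G\<^esub> inv\<^bsub>G\<^esub> h) =
          (\<mu> g * \<mu> (inv\<^bsub>G\<^esub> g)) * (\<mu> h * \<mu> (inv\<^bsub>G\<^esub> h))"
        using gh by (simp add: mult)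
      then show ?thesis using gh by (simp add: inv)
    qed
    then show ?thesis by auto
  qed
  ultimately show ?thesis
    using assms(3) generate_subgroup_incl unfolding derived_def by blast
qed

text \<open>Conjugation permutes the elements of a normal subgroup, so every summand of the induction
  formula contributes the same.\<close>

lemma sum_induced_char_normal:
  assumes "group G" "finite (carrier G)" "D \<lhd> G"
  shows "(\<Sum>d\<in>D. induced_char G H \<mu> d) = of_nat (card (carrier G)) / of_nat (card H) * (\<Sum>d\<in>D \<inter> H. \<mu> d)"
proof -
  interpret group G by fact
  interpret D: normal D G by fact
  have finD: "finite D" using finite_subset[OF D.subset assms(2)] .
  let ?f = "\<lambda>g. if g \<in> H then \<mu> g else 0"
  have "(\<Sum>d\<in>D. induced_char G H \<mu> d) =
      (\<Sum>d\<in>D. \<Sum>x\<in>carrier G. ?f (x \<otimes>\<^bsub>G\<^esub> d \<otimes>\<^bsub>G\<^esub> inv\<^bsub>G\<^esub> x)) / of_nat (card H)"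
    by (simp add: induced_char_def sum_divide_distrib)
  also have "(\<Sum>d\<in>D. \<Sum>x\<in>carrier G. ?f (x \<otimes>\<^bsub>G\<^esub> d \<otimes>\<^bsub>G\<^esub> inv\<^bsub>G\<^esub> x)) =
      (\<Sum>x\<in>carrier G. \<Sum>d\<in>D. ?f (x \<otimes>\<^bsub>G\<^esub> d \<otimes>\<^bsub>G\<^esub> inv\<^bsub>G\<^esub> x))"
    by (rule sum.swap)
  also have "\<dots> = (\<Sum>x\<in>carrier G. \<Sum>d\<in>D. ?f d)"
  proof (rule sum.cong[OF refl])
    fix x assume x: "x \<in> carrier G"
    have canc: "x \<otimes>\<^bsub>G\<^esub> (inv\<^bsub>G\<^esub> x \<otimes>\<^bsub>G\<^esub> d \<otimes>\<^bsub>G\<^esub> x) \<otimes>\<^bsub>G\<^esub> inv\<^bsub>G\<^esub> x = d"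
      "inv\<^bsub>G\<^esub> x \<otimes>\<^bsub>G\<^esub> (x \<otimes>\<^bsub>G\<^esub> d \<otimes>\<^bsub>G\<^esub> inv\<^bsub>G\<^esub> x) \<otimes>\<^bsub>G\<^esub> x = d" if "d \<in> D" for d
      using x D.mem_carrier[OF that] by (simp_all add: m_assoc) (simp_all flip: m_assoc)
    have "bij_betw (\<lambda>d. x \<otimes>\<^bsub>G\<^esub> d \<otimes>\<^bsub>G\<^esub> inv\<^bsub>G\<^esub> x) D D"
      by (rule bij_betw_byWitness[of _ "\<lambda>d. inv\<^bsub>G\<^esub> x \<otimes>\<^bsub>G\<^esub> d \<otimes>\<^bsub>G\<^esub> x"])
        (use x D.inv_op_closed1 D.inv_op_closed2 canc in auto)
    then show "(\<Sum>d\<in>D. ?f (x \<otimes>\<^bsub>G\<^esub> d \<otimes>\<^bsub>G\<^esub> inv\<^bsub>G\<^esub> x)) = (\<Sum>d\<in>D. ?f d)"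
      by (rule sum.reindex_bij_betw)
  qed
  also have "\<dots> = of_nat (card (carrier G)) * (\<Sum>d\<in>D \<inter> H. \<mu> d)"
    using finD by (simp add: sum.inter_restrict)
  finally show ?thesis by simp
qed

section \<open>Super-monomiality\<close>

theorem theorem1p2:
  fixes G :: "('g, 'b) monoid_scheme"
    and N :: "'g set"
    and \<theta> :: "'g \<Rightarrow> complex"
  assumes "group G" and "finite (carrier G)" and "M_group G"
    and "N \<lhd> G"
    and "\<theta> \<in> Irr (G\<lparr>carrier := N\<rparr>)"
    and "\<exists>\<chi> H. irreducible_constituent G \<chi> (induced_char G N \<theta>) \<and>
               H \<in> monomial_subgroups G \<chi> \<and>
               derived G (derived G N) \<inter> H \<subseteq> derived G H"
  shows "super_monomial (G\<lparr>carrier := N\<rparr>) \<theta>"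
proof -
  interpret G: group G by fact
  interpret N: normal N G by fact
  let ?D = "derived G (derived G N)"
  have D: "?D \<lhd> G" using G.derived_is_normal assms(4) by blast
  then interpret D: normal ?D G .
  obtain \<chi> H \<mu> where const: "irreducible_constituent G \<chi> (induced_char G N \<theta>)"
    and H: "subgroup H G" and \<mu>: "\<mu> \<in> linear_characters (G\<lparr>carrier := H\<rparr>)"
    and \<chi>: "induced_char G H \<mu> = \<chi>" and DH: "?D \<inter> H \<subseteq> derived G H"
    using assms(6) unfolding monomial_subgroups_def by blast
  have cardG: "card (carrier G) \<noteq> 0" using assms(2) G.one_closed by auto
  have DN: "?D \<subseteq> N"
    using G.derived_incl[OF G.derived_incl N.subgroup_axioms] N.subgroup_axioms by blast
  have \<mu>1: "\<mu> d = 1" if d: "d \<in> ?D \<inter> H" for d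
    using linear_char_trivial_on_derived[OF G.subgroup_imp_group[OF H] \<mu>, of d]
      G.derived_consistent[OF order_refl H] d DH by auto
  \<comment> \<open>Every summand on the \<open>H\<close> side is \<open>1\<close>, so the sum is a positive multiple of \<open>|N'' \<inter> H|\<close>.\<close>
  have sum_\<chi>: "(\<Sum>d\<in>?D. \<chi> d) \<noteq> 0"
  proof -
    have "finite H" using finite_subset[OF subgroup.subset[OF H] assms(2)] .
    moreover have "\<one>\<^bsub>G\<^esub> \<in> ?D \<inter> H" using subgroup.one_closed[OF H] by simp
    ultimately have "card H \<noteq> 0" "card (?D \<inter> H) \<noteq> 0"
      by (metis IntD2 card_0_eq empty_iff, metis card_0_eq empty_iff finite_Int)
    moreover have "(\<Sum>d\<in>?D \<inter> H. \<mu> d) = of_nat (card (?D \<inter> H))"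
      using sum.cong[OF refl \<mu>1, of "?D \<inter> H"] by simp
    ultimately show ?thesis
      using cardG sum_induced_char_normal[OF assms(1,2) D, of H \<mu>] unfolding \<chi> by simp
  qed
  have nat_sum: "\<exists>k::nat. (\<Sum>d\<in>?D. \<psi> d) = of_nat k" if \<psi>: "\<psi> \<in> characters G" for \<psi>
  proof -
    obtain n \<rho> where rep: "representation G n \<rho>" and \<psi>': "\<psi> = afforded_char G \<rho>"
      using \<psi> unfolding characters_def by blast
    interpret finite_group_rep G n \<rho> using rep assms(2) by unfold_locales
    show ?thesis unfolding \<psi>' by (rule sum_char_nat[OF D.subgroup_axioms])
  qed
  have \<chi>_char: "\<chi> \<in> characters G"
    using const unfolding irreducible_constituent_def Irr_def characters_def irreducible_representation_def
    by blast
  \<comment> \<open>The other constituents contribute natural numbers, so nothing cancels.\<close>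
  have "(\<Sum>d\<in>?D. induced_char G N \<theta> d) \<noteq> 0"
  proof (cases "induced_char G N \<theta> = \<chi>")
    case False
    then obtain \<psi> where \<psi>: "\<psi> \<in> characters G" and eq: "induced_char G N \<theta> = (\<lambda>g. \<chi> g + \<psi> g)"
      using const unfolding irreducible_constituent_def by blast
    obtain k l :: nat where "(\<Sum>d\<in>?D. \<chi> d) = of_nat k" "(\<Sum>d\<in>?D. \<psi> d) = of_nat l"
      using nat_sum \<psi> \<chi>_char by metis
    then show ?thesis using sum_\<chi> by (simp add: eq sum.distrib flip: of_nat_add)
  qed (use sum_\<chi> in simp)
  then have sum_\<theta>: "(\<Sum>d\<in>?D. \<theta> d) \<noteq> 0"
    using DN by (simp add: sum_induced_char_normal[OF assms(1,2) D] Int_absorb2)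
  show ?thesis
    unfolding super_monomial_def
  proof (intro conjI allI impI)
    fix K \<psi>
    assume K_N: "subgroup K (G\<lparr>carrier := N\<rparr>)"
      and \<psi>_irr: "\<psi> \<in> Irr (G\<lparr>carrier := N, carrier := K\<rparr>)"
      and prim: "primitive_char (G\<lparr>carrier := N, carrier := K\<rparr>) \<psi>"
      and ind: "induced_char (G\<lparr>carrier := N\<rparr>) K \<psi> = \<theta>"
    let ?N = "G\<lparr>carrier := N\<rparr>" and ?K = "G\<lparr>carrier := K\<rparr>"
    have K: "subgroup K G" using G.incl_subgroup[OF N.subgroup_axioms K_N] .
    have KN: "K \<subseteq> N" using subgroup.subset[OF K_N] by simp
    interpret K: group ?K using G.subgroup_imp_group[OF K] .
    obtain n \<rho> where irr: "irreducible_representation ?K n \<rho>" and \<psi>: "\<psi> = afforded_char ?K \<rho>"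
      using \<psi>_irr unfolding Irr_def by auto
    interpret K: irreducible_rep ?K n \<rho>
      using irr finite_subset[OF subgroup.subset[OF K] assms(2)]
      by unfold_locales (auto simp: irreducible_representation_def)
    have finN: "finite (carrier ?N)" using finite_subset[OF N.subset assms(2)] by simp
    have D_N: "?D \<lhd> ?N"
      using G.normal_restrict_supergroup[OF N.subgroup_axioms D DN] .
    have DK: "?D \<inter> K \<lhd> ?K"
      using G.normal_Int_subgroup[OF K D] by (simp add: Int_commute)
    \<comment> \<open>The character \<open>\<theta>\<close> is itself induced, so the sum formula applies again, now inside \<open>N\<close>.\<close>
    have "(\<Sum>d\<in>?D \<inter> K. \<psi> d) \<noteq> 0"
      using sum_\<theta> sum_induced_char_normal[OF G.subgroup_imp_group[OF N.subgroup_axioms] finN D_N, of K \<psi>]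
      by (auto simp: ind)
    then have ker: "\<rho> d = 1\<^sub>m n" if "d \<in> ?D \<inter> K" for d
      using K.normal_in_kernel[OF DK _ that] by (simp add: \<psi>)
    have K': "derived G K \<subseteq> K" using G.derived_incl[OF order_refl K] .
    have "derived ?K (derived ?K (carrier ?K)) = derived G (derived G K)"
      using G.derived_consistent[OF order_refl K] G.derived_consistent[OF K' K] by simp
    moreover have "derived G (derived G K) \<subseteq> ?D \<inter> K"
      using G.mono_derived[OF G.mono_derived[OF KN]] G.derived_incl[OF K' K] by blast
    ultimately have "n = 1"
      using K.primitive_metabelian_degree_one prim ker by (auto simp: \<psi>)
    then show "\<psi> \<one>\<^bsub>?N\<^esub> = 1" using K.char_one by (simp add: \<psi>)
  qed (rule assms(5))
qed

end
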